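(* For every natural number $n>0$, \[ \operatorname{IsoType}(\mathbb{EQ}, \Sigma^{0}_{n})\subsetneq \operatorname{IsoType}(\mathbb{EQ}, \Pi^{0}_{n}) = \operatorname{IsoType}(\mathbb{EQ}, \Delta^{0}_{n+1}). \]
   Context: An equivalence structure is a structure $\langle \omega, R\rangle$ where $R\subseteq\omega^2$ is an equivalence relation on $\omega$ (the domain is always $\omega$). For a complexity class $\Gamma$ of the arithmetical hierarchy, the structure $\langle\omega,R\rangle$ is called a $\Gamma$ equivalence structure if the relation $R$, viewed as a subset of $\omega^2$, belongs to $\Gamma$. $\mathbb{EQ}$ denotes the class of countable equivalence structures, and $\operatorname{IsoType}(\mathbb{EQ},\Gamma)$ denotes the collection of isomorphism types realized by $\Gamma$ equivalence structures. *)

theory Defs imports Main begin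

text \<open>Total recursive functions: the least class containing the initial functions and closed
  under composition, primitive recursion and \<^emph>\<open>regular\<close> minimization (minimization applied
  only where a zero always exists).  A \<open>k\<close>-ary function is a function on lists, of which only
  the values on lists of length \<open>k\<close> are meaningful.\<close>

inductive total_recursive :: "nat \<Rightarrow> (nat list \<Rightarrow> nat) \<Rightarrow> bool" where
  zero: "total_recursive k (\<lambda>xs. 0)"
| succ: "total_recursive 1 (\<lambda>xs. Suc (xs ! 0))"
| proj: "i < k \<Longrightarrow> total_recursive k (\<lambda>xs. xs ! i)"
| comp: "total_recursive (length gs) f \<Longrightarrow> \<forall>g\<in>set gs. total_recursive k g \<Longrightarrow>
    total_recursive k (\<lambda>xs. f (map (\<lambda>g. g xs) gs))"
| prim_rec: "total_recursive k f \<Longrightarrow> total_recursive (Suc (Suc k)) g \<Longrightarrow>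
    total_recursive (Suc k) (\<lambda>xs. rec_nat (f (tl xs)) (\<lambda>y r. g (y # r # tl xs)) (hd xs))"
| minim: "total_recursive (Suc k) f \<Longrightarrow> \<forall>xs. length xs = k \<longrightarrow> (\<exists>y. f (y # xs) = 0) \<Longrightarrow>
    total_recursive k (\<lambda>xs. LEAST y. f (y # xs) = 0)"

definition computable_rel :: "nat \<Rightarrow> (nat list \<Rightarrow> bool) \<Rightarrow> bool" where
  "computable_rel k P \<longleftrightarrow>
    (\<exists>f. total_recursive k f \<and> (\<forall>xs. length xs = k \<longrightarrow> f xs = (if P xs then 1 else 0)))"

text \<open>The first argument is the level of the hierarchy, the second the arity of the relation.\<close>

fun is_Sigma :: "nat \<Rightarrow> nat \<Rightarrow> (nat list \<Rightarrow> bool) \<Rightarrow> bool"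
  and is_Pi :: "nat \<Rightarrow> nat \<Rightarrow> (nat list \<Rightarrow> bool) \<Rightarrow> bool" where
  "is_Sigma 0 k P \<longleftrightarrow> computable_rel k P"
| "is_Sigma (Suc n) k P \<longleftrightarrow>
    (\<exists>Q. is_Pi n (Suc k) Q \<and> (\<forall>xs. length xs = k \<longrightarrow> (P xs \<longleftrightarrow> (\<exists>y. Q (y # xs)))))"
| "is_Pi 0 k P \<longleftrightarrow> computable_rel k P"
| "is_Pi (Suc n) k P \<longleftrightarrow>
    (\<exists>Q. is_Sigma n (Suc k) Q \<and> (\<forall>xs. length xs = k \<longrightarrow> (P xs \<longleftrightarrow> (\<forall>y. Q (y # xs)))))"

definition Sigma0 :: "nat \<Rightarrow> nat rel set" where
  "Sigma0 n = {R. is_Sigma n 2 (\<lambda>xs. (xs ! 0, xs ! 1) \<in> R)}"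

definition Pi0 :: "nat \<Rightarrow> nat rel set" where
  "Pi0 n = {R. is_Pi n 2 (\<lambda>xs. (xs ! 0, xs ! 1) \<in> R)}"

definition Delta0 :: "nat \<Rightarrow> nat rel set" where
  "Delta0 n = Sigma0 n \<inter> Pi0 n"

text \<open>A structure with domain \<open>\<omega>\<close> and one binary relation is identified with its relation.\<close>

definition EQ :: "nat rel set" where
  "EQ = {R. equiv UNIV R}"

definition isomorphic :: "nat rel \<Rightarrow> nat rel \<Rightarrow> bool" where
  "isomorphic R S \<longleftrightarrow> (\<exists>f. bij f \<and> (\<forall>x y. (x, y) \<in> R \<longleftrightarrow> (f x, f y) \<in> S))"

definition iso_type :: "nat rel \<Rightarrow> nat rel set" where
  "iso_type R = {S. isomorphic R S}"

definition IsoType :: "nat rel set \<Rightarrow> nat rel set \<Rightarrow> nat rel set set" where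
  "IsoType K \<Gamma> = iso_type ` (K \<inter> \<Gamma>)"

end

theory Submission
  imports Defs "HOL-Library.Nat_Bijection" "HOL-Library.Infinite_Set"
begin

text \<open>Since \<open>\<Sigma>\<^sub>n\<close> and \<open>\<Pi>\<^sub>n\<close> relations are \<open>\<Delta>\<^sub>n\<^sub>+\<^sub>1\<close>, two things have to be shown.

  Every \<open>\<Delta>\<^sub>n\<^sub>+\<^sub>1\<close> equivalence structure \<open>R\<close> has a \<open>\<Pi>\<^sub>n\<close> copy. With finitely many classes it even has a
  computable copy. Otherwise let \<open>A\<close> be the set of pairs \<open>(y, i)\<close> such that \<open>y\<close> lies in the \<open>i\<close>-th class
  but is not its least element. Being \<open>\<Sigma>\<^sub>n\<^sub>+\<^sub>1\<close>, it is the projection of a \<open>\<Pi>\<^sub>n\<close> set \<open>B\<close> of triples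
  \<open>(w, y, i)\<close> in which \<open>w\<close> is unique, so \<open>B\<close> can stand for the elements that are not least in their
  class. The complement of \<open>B\<close> is an infinite \<open>\<Sigma>\<^sub>n\<close> set and therefore has a \<open>\<Delta>\<^sub>n\<close> numbering; let its
  \<open>i\<close>-th element stand for the least element of the \<open>i\<close>-th class. Thus the numbers outside \<open>B\<close> do not
  have to be hidden anywhere, and "same class" is \<open>\<Pi>\<^sub>n\<close>.

  Some \<open>\<Delta>\<^sub>n\<^sub>+\<^sub>1\<close> equivalence structure has no \<open>\<Sigma>\<^sub>n\<close> copy. The finite class sizes of a \<open>\<Sigma>\<^sub>n\<close>
  structure form a \<open>\<Sigma>\<^sub>n\<^sub>+\<^sub>1\<close> set, whereas every \<open>\<Sigma>\<^sub>n\<^sub>+\<^sub>2\<close> set \<open>{k. \<exists>x. Q x k}\<close> is coded by the class sizes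
  of a \<open>\<Delta>\<^sub>n\<^sub>+\<^sub>1\<close> structure: the class of \<open>(x, k)\<close> starts with \<open>k + 1\<close> elements and becomes infinite once
  \<open>Q x k\<close> is refuted. That the hierarchy is proper follows from a universal \<open>\<Sigma>\<^sub>1\<close> relation.\<close>

subsection \<open>Recursive functions as unary functions of tuple codes\<close>

definition npair :: "nat \<Rightarrow> nat \<Rightarrow> nat" where
  "npair x y = prod_encode (x, y)"

definition nfst :: "nat \<Rightarrow> nat" where
  "nfst x = fst (prod_decode x)"

definition nsnd :: "nat \<Rightarrow> nat" where
  "nsnd x = snd (prod_decode x)"

lemma nfst_npair [simp]: "nfst (npair x y) = x"
  by (simp add: nfst_def npair_def)

lemma nsnd_npair [simp]: "nsnd (npair x y) = y"
  by (simp add: nsnd_def npair_def)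

lemma npair_nfst_nsnd [simp]: "npair (nfst x) (nsnd x) = x"
  by (simp add: nfst_def nsnd_def npair_def)

lemma npair_eq_iff [simp]: "npair x y = npair x' y' \<longleftrightarrow> x = x' \<and> y = y'"
  by (simp add: npair_def)

lemma ex_npair: "(\<exists>z. P z) \<longleftrightarrow> (\<exists>x y. P (npair x y))"
  by (metis npair_nfst_nsnd)

text \<open>Packing all arguments into one number removes arities and leaves composition with a
  single inner function. The recursion argument and the minimization variable sit in the first
  component, like the list head in \<open>total_recursive\<close>.\<close>

inductive urec :: "(nat \<Rightarrow> nat) \<Rightarrow> bool" where
  zero: "urec (\<lambda>x. 0)"
| succ: "urec Suc"
| first: "urec nfst"
| second: "urec nsnd"
| pair: "urec f \<Longrightarrow> urec g \<Longrightarrow> urec (\<lambda>x. npair (f x) (g x))"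
| comp: "urec f \<Longrightarrow> urec g \<Longrightarrow> urec (\<lambda>x. f (g x))"
| prim_rec: "urec f \<Longrightarrow> urec g \<Longrightarrow>
    urec (\<lambda>x. rec_nat (f (nsnd x)) (\<lambda>y r. g (npair y (npair r (nsnd x)))) (nfst x))"
| minim: "urec f \<Longrightarrow> \<forall>x. \<exists>y. f (npair y x) = 0 \<Longrightarrow> urec (\<lambda>x. LEAST y. f (npair y x) = 0)"

text \<open>With right-nested pairs, prefixing a quantified variable, \<open>y # xs\<close>, becomes
  \<open>npair y e\<close>; this keeps the hierarchies on lists and on codes aligned.\<close>

fun tuple_encode :: "nat list \<Rightarrow> nat" where
  "tuple_encode [] = 0"
| "tuple_encode (x # xs) = npair x (tuple_encode xs)"

fun tuple_decode :: "nat \<Rightarrow> nat \<Rightarrow> nat list" where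
  "tuple_decode 0 e = []"
| "tuple_decode (Suc k) e = nfst e # tuple_decode k (nsnd e)"

lemma length_tuple_decode [simp]: "length (tuple_decode k e) = k"
  by (induction k arbitrary: e) auto

lemma tuple_decode_encode [simp]: "length xs = k \<Longrightarrow> tuple_decode k (tuple_encode xs) = xs"
  by (induction xs arbitrary: k) auto

lemma urec_id: "urec (\<lambda>x. x)"
  using urec.pair[OF urec.first urec.second] by simp

lemma urec_nth_tuple_decode: "i < k \<Longrightarrow> urec (\<lambda>e. tuple_decode k e ! i)"
proof (induction k arbitrary: i)
  case (Suc k)
  show ?case
  proof (cases i)
    case 0
    then show ?thesis using urec.first by simp
  next
    case (Suc j)
    then show ?thesis using Suc.IH[of j] Suc.prems urec.comp[OF _ urec.second] by simp
  qed
qed simp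

lemma urec_tuple_encode:
  "\<forall>g\<in>set gs. urec (\<lambda>e. g (tuple_decode k e)) \<Longrightarrow>
    urec (\<lambda>e. tuple_encode (map (\<lambda>g. g (tuple_decode k e)) gs))"
  by (induction gs) (auto intro: urec.zero urec.pair)

lemma urec_if_total_recursive:
  "total_recursive k F \<Longrightarrow> urec (\<lambda>e. F (tuple_decode k e))"
proof (induction rule: total_recursive.induct)
  case (zero k)
  then show ?case by (rule urec.zero)
next
  case succ
  then show ?case using urec.comp[OF urec.succ urec.first] by simp
next
  case (proj i k)
  then show ?case by (rule urec_nth_tuple_decode)
next
  case (comp gs f k)
  then have "urec (\<lambda>e. tuple_encode (map (\<lambda>g. g (tuple_decode k e)) gs))"
    by (intro urec_tuple_encode) auto
  from urec.comp[OF comp.IH(1) this] show ?case by simp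
next
  case (prim_rec k f g)
  from urec.prim_rec[OF prim_rec.IH] show ?case by simp
next
  case (minim k f)
  have "\<forall>x. \<exists>y. f (tuple_decode (Suc k) (npair y x)) = 0" using minim.hyps by simp
  from urec.minim[OF minim.IH this] show ?case by simp
qed

text \<open>Total recursiveness in the sense of \<^const>\<open>total_recursive\<close> depends on the values at lists of
  the wrong length; \<open>trec\<close> does not.\<close>

definition trec :: "nat \<Rightarrow> (nat list \<Rightarrow> nat) \<Rightarrow> bool" where
  "trec k f \<longleftrightarrow> (\<exists>F. total_recursive k F \<and> (\<forall>xs. length xs = k \<longrightarrow> F xs = f xs))"

lemma trecI: "total_recursive k f \<Longrightarrow> trec k f"
  unfolding trec_def by blast

lemma trec_cong: "trec k f \<Longrightarrow> (\<And>xs. length xs = k \<Longrightarrow> f xs = g xs) \<Longrightarrow> trec k g"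
  unfolding trec_def by (metis)

lemma trec_comp:
  assumes "trec (length gs) f" "\<forall>g\<in>set gs. trec k g"
  shows "trec k (\<lambda>xs. f (map (\<lambda>g. g xs) gs))"
proof -
  obtain F where F: "total_recursive (length gs) F" "\<And>xs. length xs = length gs \<Longrightarrow> F xs = f xs"
    using assms(1) unfolding trec_def by blast
  have "\<forall>g\<in>set gs. \<exists>G. total_recursive k G \<and> (\<forall>xs. length xs = k \<longrightarrow> G xs = g xs)"
    using assms(2) unfolding trec_def by blast
  then obtain G where G: "\<And>g. g \<in> set gs \<Longrightarrow> total_recursive k (G g)"
    "\<And>g xs. g \<in> set gs \<Longrightarrow> length xs = k \<Longrightarrow> G g xs = g xs"
    by metis
  have "total_recursive k (\<lambda>xs. F (map (\<lambda>g. g xs) (map G gs)))"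
    by (rule total_recursive.comp) (auto simp: F G)
  moreover have "map (\<lambda>g. g xs) (map G gs) = map (\<lambda>g. g xs) gs" if "length xs = k" for xs
    using G(2) that by simp
  ultimately show ?thesis unfolding trec_def
    by (intro exI[of _ "\<lambda>xs. F (map (\<lambda>g. g xs) (map G gs))"] conjI allI impI)
      (simp_all only: F(2) length_map)
qed

lemma trec_comp1: "trec 1 f \<Longrightarrow> trec k g \<Longrightarrow> trec k (\<lambda>xs. f [g xs])"
  using trec_comp[of "[g]" f k] by simp

lemma trec_comp2: "trec 2 f \<Longrightarrow> trec k g \<Longrightarrow> trec k h \<Longrightarrow> trec k (\<lambda>xs. f [g xs, h xs])"
  using trec_comp[of "[g, h]" f k] by (simp add: numeral_2_eq_2)

lemma trec_prim_rec:
  assumes "trec k f" "trec (Suc (Suc k)) g"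
  shows "trec (Suc k) (\<lambda>xs. rec_nat (f (tl xs)) (\<lambda>y r. g (y # r # tl xs)) (hd xs))"
proof -
  obtain F where F: "total_recursive k F" "\<And>xs. length xs = k \<Longrightarrow> F xs = f xs"
    using assms(1) unfolding trec_def by blast
  obtain G where G: "total_recursive (Suc (Suc k)) G"
    "\<And>xs. length xs = Suc (Suc k) \<Longrightarrow> G xs = g xs"
    using assms(2) unfolding trec_def by blast
  show ?thesis unfolding trec_def
    using total_recursive.prim_rec[OF F(1) G(1)] F(2) G(2)
    by (intro exI[of _ "\<lambda>xs. rec_nat (F (tl xs)) (\<lambda>y r. G (y # r # tl xs)) (hd xs)"]) simp
qed

lemma trec_minim:
  assumes "trec (Suc k) f" "\<And>xs. length xs = k \<Longrightarrow> \<exists>y. f (y # xs) = 0"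
  shows "trec k (\<lambda>xs. LEAST y. f (y # xs) = 0)"
proof -
  obtain F where F: "total_recursive (Suc k) F" "\<And>xs. length xs = Suc k \<Longrightarrow> F xs = f xs"
    using assms(1) unfolding trec_def by blast
  have "\<forall>xs. length xs = k \<longrightarrow> (\<exists>y. F (y # xs) = 0)" using assms(2) F(2) by simp
  from total_recursive.minim[OF F(1) this] show ?thesis unfolding trec_def
    by (intro exI conjI) (assumption, simp add: F(2))
qed

section \<open>Recursiveness of arithmetic, of pairing and of its inverses\<close>

lemma trec_zero: "trec k (\<lambda>xs. 0)"
  by (intro trecI total_recursive.zero)

lemma trec_proj: "i < k \<Longrightarrow> trec k (\<lambda>xs. xs ! i)"
  by (intro trecI total_recursive.proj)

lemma trec_Suc: "trec k f \<Longrightarrow> trec k (\<lambda>xs. Suc (f xs))"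
  using trec_comp1[OF trecI[OF total_recursive.succ]] by simp

lemma length_2E: "length xs = 2 \<Longrightarrow> (\<And>x y. xs = [x, y] \<Longrightarrow> P) \<Longrightarrow> P"
  by (auto simp: numeral_2_eq_2 length_Suc_conv)

lemma trec_add:
  assumes "trec k f" "trec k g"
  shows "trec k (\<lambda>xs. f xs + g xs)"
proof -
  have eq: "rec_nat y (\<lambda>_. Suc) x = x + y" for x y :: nat
    by (induction x) auto
  have "trec 2 (\<lambda>xs. rec_nat (tl xs ! 0) (\<lambda>y r. Suc ((y # r # tl xs) ! 1)) (hd xs))"
    unfolding numeral_2_eq_2 by (intro trec_prim_rec trec_proj trec_Suc) auto
  then have "trec 2 (\<lambda>xs. xs ! 0 + xs ! 1)"
    by (rule trec_cong)
      (auto elim!: length_2E simp: eq)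
  from trec_comp2[OF this assms] show ?thesis by simp
qed

lemma trec_diff:
  assumes "trec k f" "trec k g"
  shows "trec k (\<lambda>xs. f xs - g xs)"
proof -
  have "trec (Suc 0) (\<lambda>xs. rec_nat ((\<lambda>_. 0) (tl xs)) (\<lambda>y r. (y # r # tl xs) ! 0) (hd xs))"
    by (intro trec_prim_rec trec_proj trec_zero) auto
  moreover have "rec_nat 0 (\<lambda>y r. y) x = x - 1" for x :: nat
    by (cases x) auto
  ultimately have pred: "trec 1 (\<lambda>xs. hd xs - 1)"
    by simp
  have eq: "rec_nat y (\<lambda>_ r. r - 1) x = y - x" for x y :: nat
    by (induction x) auto
  have "trec 2 (\<lambda>xs. rec_nat (tl xs ! 0) (\<lambda>y r. hd [(y # r # tl xs) ! 1] - 1) (hd xs))"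
    unfolding numeral_2_eq_2 by (intro trec_prim_rec trec_proj trec_comp1[OF pred]) auto
  then have "trec 2 (\<lambda>xs. xs ! 1 - xs ! 0)"
    by (rule trec_cong)
      (auto elim!: length_2E simp: eq simp del: One_nat_def)
  from trec_comp2[OF this assms(2,1)] show ?thesis by simp
qed

lemma trec_triangle:
  assumes "trec k f"
  shows "trec k (\<lambda>xs. triangle (f xs))"
proof -
  have eq: "rec_nat 0 (\<lambda>y r. r + Suc y) x = triangle x" for x
    by (induction x) auto
  have "trec (Suc 0) (\<lambda>xs. rec_nat ((\<lambda>_. 0) (tl xs))
    (\<lambda>y r. (y # r # tl xs) ! 1 + Suc ((y # r # tl xs) ! 0)) (hd xs))"
    by (intro trec_prim_rec trec_proj trec_zero trec_add trec_Suc) auto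
  then have "trec 1 (\<lambda>xs. triangle (hd xs))"
    by (simp add: eq del: add_Suc_right)
  from trec_comp1[OF this assms] show ?thesis by simp
qed

lemma trec_npair: "trec k f \<Longrightarrow> trec k g \<Longrightarrow> trec k (\<lambda>xs. npair (f xs) (g xs))"
  unfolding npair_def prod_encode_def by (simp add: trec_add trec_triangle)

text \<open>As \<open>npair x y\<close> is \<open>triangle (x + y) + x\<close>, the sum
  \<open>x + y\<close> is the least \<open>t\<close> whose \<open>triangle (Suc t)\<close> exceeds
  the code. Truncated subtraction turns this into the search for a zero.\<close>

definition tri_root :: "nat \<Rightarrow> nat" where
  "tri_root x = (LEAST t. Suc x - triangle (Suc t) = 0)"

lemma le_triangle: "x \<le> triangle x"
  by (induction x) auto

lemma triangle_mono: "x \<le> y \<Longrightarrow> triangle x \<le> triangle y"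
  by (induction rule: dec_induct) auto

lemma tri_root_npair: "tri_root (npair x y) = x + y"
  unfolding tri_root_def npair_def
proof (rule Least_equality)
  fix t assume t: "Suc (prod_encode (x, y)) - triangle (Suc t) = 0"
  show "x + y \<le> t"
  proof (rule ccontr)
    assume "\<not> x + y \<le> t"
    then have "triangle (Suc t) \<le> triangle (x + y)" by (intro triangle_mono) simp
    then show False using t by (simp add: prod_encode_def del: triangle_Suc)
  qed
qed (simp add: prod_encode_def)

lemma trec_tri_root:
  assumes "trec k f"
  shows "trec k (\<lambda>xs. tri_root (f xs))"
proof -
  have "trec 1 (\<lambda>xs. LEAST t. Suc ((t # xs) ! 1) - triangle (Suc ((t # xs) ! 0)) = 0)"
  proof (rule trec_minim)
    fix xs :: "nat list"
    \<comment> \<open>The argument itself is a zero, so the minimization is regular.\<close>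
    have "Suc ((xs ! 0 # xs) ! 1) - triangle (Suc ((xs ! 0 # xs) ! 0)) = 0"
      using le_triangle[of "Suc (xs ! 0)"] by simp
    then show "\<exists>y. Suc ((y # xs) ! 1) - triangle (Suc ((y # xs) ! 0)) = 0" by blast
  qed (intro trec_diff trec_Suc trec_triangle trec_proj; simp)
  then have "trec 1 (\<lambda>xs. tri_root (xs ! 0))" unfolding tri_root_def by simp
  from trec_comp1[OF this assms] show ?thesis by simp
qed

lemma nfst_eq: "nfst z = z - triangle (tri_root z)"
proof -
  have "nfst (npair x y) = npair x y - triangle (tri_root (npair x y))" for x y
    unfolding tri_root_npair nfst_npair by (simp add: npair_def prod_encode_def)
  from this[of "nfst z" "nsnd z"] show ?thesis by simp
qed

lemma nsnd_eq: "nsnd z = tri_root z - nfst z"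
proof -
  have "nsnd (npair x y) = tri_root (npair x y) - nfst (npair x y)" for x y
    unfolding tri_root_npair by simp
  from this[of "nfst z" "nsnd z"] show ?thesis by simp
qed

lemma trec_nfst: "trec k f \<Longrightarrow> trec k (\<lambda>xs. nfst (f xs))"
  unfolding nfst_eq by (intro trec_diff trec_triangle trec_tri_root)

lemma trec_nsnd: "trec k f \<Longrightarrow> trec k (\<lambda>xs. nsnd (f xs))"
  unfolding nsnd_eq by (intro trec_diff trec_nfst trec_tri_root)

text \<open>Generalizing over the inner function \<open>F\<close> makes composition an instance of
  the induction hypotheses.\<close>

lemma trec_if_urec: "urec f \<Longrightarrow> trec k F \<Longrightarrow> trec k (\<lambda>xs. f (F xs))"
proof (induction arbitrary: k F rule: urec.induct)
  case (prim_rec f g)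
  have "trec 2 (\<lambda>xs. rec_nat (f (tl xs ! 0))
    (\<lambda>y r. g (npair ((y # r # tl xs) ! 0) (npair ((y # r # tl xs) ! 1) ((y # r # tl xs) ! 2))))
    (hd xs))"
    unfolding numeral_2_eq_2 by (intro trec_prim_rec prim_rec.IH trec_npair trec_proj) auto
  from trec_comp2[OF this trec_nfst[OF prim_rec.prems] trec_nsnd[OF prim_rec.prems]]
  show ?case by (simp add: numeral_2_eq_2)
next
  case (minim f)
  have "trec 1 (\<lambda>xs. LEAST y. f (npair ((y # xs) ! 0) ((y # xs) ! 1)) = 0)"
    by (intro trec_minim minim.IH trec_npair trec_proj) (use minim.hyps in auto)
  from trec_comp1[OF this minim.prems] show ?case by simp
qed (auto intro: trec_zero trec_Suc trec_nfst trec_nsnd trec_npair)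

lemma trec_tuple_encode_map:
  "\<forall>g\<in>set gs. trec k g \<Longrightarrow> trec k (\<lambda>xs. tuple_encode (map (\<lambda>g. g xs) gs))"
  by (induction gs) (auto intro: trec_zero trec_npair)

lemma trec_tuple_encode: "trec k tuple_encode"
proof -
  have "trec k (\<lambda>xs. tuple_encode (map (\<lambda>g. g xs) (map (\<lambda>i xs. xs ! i) [0..<k])))"
    by (intro trec_tuple_encode_map) (auto intro: trec_proj)
  then show ?thesis by (rule trec_cong) (auto simp: comp_def map_nth)
qed

section \<open>Closure properties of unary recursive functions\<close>

named_theorems urec_intros
declare urec_id [urec_intros]

lemma urec_cong: "urec f \<Longrightarrow> (\<And>e. f e = g e) \<Longrightarrow> urec g"
  by (metis ext)

lemma urec_const [urec_intros]: "urec (\<lambda>e. c)"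
  by (induction c) (auto intro: urec.zero urec.comp[OF urec.succ])

lemma urec_Suc [urec_intros]: "urec f \<Longrightarrow> urec (\<lambda>e. Suc (f e))"
  by (rule urec.comp[OF urec.succ])

lemma urec_nfst [urec_intros]: "urec f \<Longrightarrow> urec (\<lambda>e. nfst (f e))"
  by (rule urec.comp[OF urec.first])

lemma urec_nsnd [urec_intros]: "urec f \<Longrightarrow> urec (\<lambda>e. nsnd (f e))"
  by (rule urec.comp[OF urec.second])

lemma urec_npair [urec_intros]: "urec f \<Longrightarrow> urec g \<Longrightarrow> urec (\<lambda>e. npair (f e) (g e))"
  by (rule urec.pair)

text \<open>The recursion is run on \<open>npair (h e) e\<close>, so the step function sees the
  whole input \<open>e\<close> as its parameter.\<close>

lemma urec_rec_nat:
  assumes "urec f" "urec (\<lambda>z. g (nfst z) (nfst (nsnd z)) (nsnd (nsnd z)))" "urec h"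
  shows "urec (\<lambda>e. rec_nat (f e) (\<lambda>y r. g y r e) (h e))"
  using urec.comp[OF urec.prim_rec[OF assms(1,2)] urec_npair[OF assms(3) urec_id]] by simp

lemma urec_add [urec_intros]:
  assumes "urec f" "urec g"
  shows "urec (\<lambda>e. f e + g e)"
proof -
  have "rec_nat x (\<lambda>_. Suc) y = x + y" for x y
    by (induction y) auto
  moreover have "urec (\<lambda>e. rec_nat (f e) (\<lambda>y r. Suc r) (g e))"
    by (intro urec_rec_nat urec_intros assms)
  ultimately show ?thesis by simp
qed

lemma urec_diff [urec_intros]:
  assumes "urec f" "urec g"
  shows "urec (\<lambda>e. f e - g e)"
proof -
  have pred: "urec (\<lambda>e. h e - 1)" if "urec h" for h
  proof -
    have "rec_nat 0 (\<lambda>y r. y) x = x - 1" for x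
      by (cases x) auto
    moreover have "urec (\<lambda>e. rec_nat 0 (\<lambda>y r. y) (h e))"
      by (intro urec_rec_nat urec_intros that)
    ultimately show ?thesis by simp
  qed
  have "rec_nat x (\<lambda>_ r. r - 1) y = x - y" for x y :: nat
    by (induction y) auto
  moreover have "urec (\<lambda>e. rec_nat (f e) (\<lambda>y r. r - 1) (g e))"
    by (intro urec_rec_nat urec_intros assms pred)
  ultimately show ?thesis by simp
qed

subsection \<open>Decidable relations\<close>

definition decidable :: "(nat \<Rightarrow> bool) \<Rightarrow> bool" where
  "decidable P \<longleftrightarrow> urec (\<lambda>e. if P e then 1 else 0)"

lemma decidable_cong: "decidable P \<Longrightarrow> (\<And>e. P e \<longleftrightarrow> Q e) \<Longrightarrow> decidable Q"
  unfolding decidable_def by (erule urec_cong) simp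

lemma decidable_eq_0: "urec f \<Longrightarrow> decidable (\<lambda>e. f e = 0)"
proof -
  assume "urec f"
  then have "urec (\<lambda>e. 1 - f e)" by (intro urec_intros)
  then show ?thesis unfolding decidable_def by (rule urec_cong) simp
qed

lemma decidable_not [urec_intros]: "decidable P \<Longrightarrow> decidable (\<lambda>e. \<not> P e)"
  unfolding decidable_def[of P] by (drule decidable_eq_0) (erule decidable_cong, simp)

lemma decidable_conj [urec_intros]:
  assumes "decidable P" "decidable Q"
  shows "decidable (\<lambda>e. P e \<and> Q e)"
proof -
  let ?b = "\<lambda>b. if b then 1 else 0 :: nat"
  \<comment> \<open>A sum of naturals is zero only if both summands are, so one zero test decides
    the conjunction.\<close>
  have "decidable (\<lambda>e. (1 - ?b (P e)) + (1 - ?b (Q e)) = 0)"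
    using assms unfolding decidable_def by (intro decidable_eq_0[unfolded decidable_def] urec_intros)
  then show ?thesis by (rule decidable_cong) simp
qed

lemma decidable_disj [urec_intros]: "decidable P \<Longrightarrow> decidable Q \<Longrightarrow> decidable (\<lambda>e. P e \<or> Q e)"
  using decidable_not[of "\<lambda>e. \<not> P e \<and> \<not> Q e"] decidable_conj[of "\<lambda>e. \<not> P e" "\<lambda>e. \<not> Q e"]
    decidable_not[of P] decidable_not[of Q] by (auto elim: decidable_cong)

lemma decidable_le [urec_intros]:
  assumes "urec f" "urec g"
  shows "decidable (\<lambda>e. f e \<le> g e)"
  using decidable_eq_0[OF urec_diff[OF assms]] by simp

lemma decidable_less [urec_intros]: "urec f \<Longrightarrow> urec g \<Longrightarrow> decidable (\<lambda>e. f e < g e)"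
  using decidable_not[OF decidable_le[of g f]] by (simp add: not_le)

lemma decidable_eq [urec_intros]: "urec f \<Longrightarrow> urec g \<Longrightarrow> decidable (\<lambda>e. f e = g e)"
  using decidable_conj[OF decidable_le[of f g] decidable_le[of g f]] by (simp add: order_eq_iff)

lemma decidable_subst: "decidable P \<Longrightarrow> urec f \<Longrightarrow> decidable (\<lambda>e. P (f e))"
  unfolding decidable_def by (rule urec.comp)

lemma urec_if [urec_intros]:
  assumes "decidable P" "urec f" "urec g"
  shows "urec (\<lambda>e. if P e then f e else g e)"
proof -
  have "urec (\<lambda>e. rec_nat (g e) (\<lambda>y r. f e) (if P e then 1 else 0))"
    using assms(1) unfolding decidable_def
    by (intro urec_rec_nat urec.comp[OF assms(2)] assms(3) urec_intros)
  then show ?thesis by (rule urec_cong) simp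
qed

text \<open>Bounded search by primitive recursion. As in all later quantifier rules, the bound
  variable is the first component of \<open>z\<close> and the free input the second.\<close>

lemma decidable_bex [urec_intros]:
  assumes "decidable (\<lambda>z. P (nfst z) (nsnd z))" "urec f"
  shows "decidable (\<lambda>e. \<exists>y<f e. P y e)"
proof -
  have "decidable (\<lambda>z. P (nfst z) (nsnd (nsnd z)))"
    using decidable_subst[OF assms(1), of "\<lambda>z. npair (nfst z) (nsnd (nsnd z))"]
    by (simp add: urec_intros)
  then have "urec (\<lambda>e. rec_nat 0 (\<lambda>y r. if P y e then 1 else r) (f e))"
    by (intro urec_rec_nat urec_intros assms(2))
  moreover have "rec_nat 0 (\<lambda>y r. if P y e then 1 else r) m = (if \<exists>y<m. P y e then 1 else 0)" for m e
    by (induction m) (auto simp: less_Suc_eq)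
  then have "\<And>e. rec_nat 0 (\<lambda>y r. if P y e then 1 else r) (f e) = (if \<exists>y<f e. P y e then 1 else 0)"
    by blast
  ultimately show ?thesis unfolding decidable_def by (rule urec_cong)
qed

lemma decidable_ball [urec_intros]:
  "decidable (\<lambda>z. P (nfst z) (nsnd z)) \<Longrightarrow> urec f \<Longrightarrow> decidable (\<lambda>e. \<forall>y<f e. P y e)"
  using decidable_not[OF decidable_bex[OF decidable_not[of "\<lambda>z. P (nfst z) (nsnd z)"]]] by simp

text \<open>Every number is read as an infinite stream with head \<open>nfst\<close> and tail
  \<open>nsnd\<close>; no length is stored, and any finite prefix can be prescribed.\<close>

definition seq_nth :: "nat \<Rightarrow> nat \<Rightarrow> nat" where
  "seq_nth s i = nfst (rec_nat s (\<lambda>_. nsnd) i)"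

lemma urec_seq_nth [urec_intros]:
  assumes "urec f" "urec g"
  shows "urec (\<lambda>e. seq_nth (f e) (g e))"
  unfolding seq_nth_def
  using urec_rec_nat[of f "\<lambda>_ r _. nsnd r" g] assms by (simp add: urec_intros)

lemma seq_nth_0: "seq_nth (npair a s) 0 = a"
  by (simp add: seq_nth_def)

lemma seq_nth_Suc: "seq_nth (npair a s) (Suc i) = seq_nth s i"
proof -
  have "rec_nat (npair a s) (\<lambda>_. nsnd) (Suc i) = rec_nat s (\<lambda>_. nsnd) i"
    by (induction i) auto
  then show ?thesis by (simp add: seq_nth_def)
qed

lemma ex_seq: "\<exists>s. \<forall>i<m. seq_nth s i = f i"
proof (induction m arbitrary: f)
  case (Suc m)
  from Suc[of "\<lambda>i. f (Suc i)"] obtain s where "\<forall>i<m. seq_nth s i = f (Suc i)" by blast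
  then have "\<forall>i<Suc m. seq_nth (npair (f 0) s) i = f i"
    by (auto simp: less_Suc_eq_0_disj seq_nth_0 seq_nth_Suc)
  then show ?case by blast
qed simp

lemma ex_seq_choice:
  assumes "\<forall>y<m. \<exists>v. P y v"
  shows "\<exists>s. \<forall>y<m. P y (seq_nth s y)"
proof -
  from assms obtain g where "\<forall>y<m. P y (g y)" by metis
  moreover obtain s where "\<forall>y<m. seq_nth s y = g y" using ex_seq by blast
  ultimately show ?thesis by (metis)
qed

definition seq_set :: "nat \<Rightarrow> nat set" where
  "seq_set s = seq_nth (nsnd s) ` {..<nfst s}"

lemma ex_seq_set: "finite S \<Longrightarrow> \<exists>s. seq_set s = S"
proof -
  assume "finite S"
  then obtain m and f :: "nat \<Rightarrow> nat" where S: "S = f ` {..<m}"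
    by (metis finite_imp_nat_seg_image_inj_on lessThan_def)
  obtain s where "\<forall>i<m. seq_nth s i = f i" using ex_seq by blast
  then have "seq_set (npair m s) = S" unfolding S seq_set_def by simp
  then show ?thesis ..
qed

lemma decidable_bex_seq_set [urec_intros]:
  assumes "decidable (\<lambda>z. P (nfst z) (nsnd z))" "urec f"
  shows "decidable (\<lambda>e. \<exists>t\<in>seq_set (f e). P t e)"
proof -
  have "decidable (\<lambda>e. \<exists>i<nfst (f e). P (seq_nth (nsnd (f e)) i) e)"
    using decidable_subst[OF assms(1), of "\<lambda>z. npair (seq_nth (nsnd (f (nsnd z))) (nfst z)) (nsnd z)"]
    by (intro decidable_bex) (simp_all add: urec_intros urec.comp[OF assms(2)] assms(2))
  then show ?thesis by (simp add: seq_set_def Bex_def)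
qed

lemma decidable_ball_seq_set [urec_intros]:
  "decidable (\<lambda>z. P (nfst z) (nsnd z)) \<Longrightarrow> urec f \<Longrightarrow> decidable (\<lambda>e. \<forall>t\<in>seq_set (f e). P t e)"
  using decidable_not[OF decidable_bex_seq_set[OF decidable_not[of "\<lambda>z. P (nfst z) (nsnd z)"]]] by simp

lemma decidable_mem_seq_set [urec_intros]:
  assumes "urec f" "urec g"
  shows "decidable (\<lambda>e. f e \<in> seq_set (g e))"
proof -
  have "decidable (\<lambda>e. \<exists>t\<in>seq_set (g e). t = f e)"
    by (intro urec_intros urec.comp[OF assms(1)] assms(2))
  then show ?thesis by simp
qed

lemma urec_mod [urec_intros]:
  assumes "urec f"
  shows "urec (\<lambda>e. f e mod p)"
proof -
  have "rec_nat 0 (\<lambda>y r. if Suc r = p then 0 else Suc r) x = x mod p" for x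
    by (induction x) (auto simp: mod_Suc)
  moreover have "urec (\<lambda>e. rec_nat 0 (\<lambda>y r. if Suc r = p then 0 else Suc r) (f e))"
    by (intro urec_rec_nat urec_intros assms)
  ultimately show ?thesis by simp
qed

text \<open>Exceptional values are corrected one at a time by case distinction. This hard-wires
  finite tables into recursive functions.\<close>

lemma urec_finite_change:
  assumes "urec g" "\<forall>x\<ge>m. f x = g x"
  shows "urec f"
  using assms(2)
proof (induction m arbitrary: f)
  case 0
  then have "f = g" by auto
  then show ?case using assms(1) by simp
next
  case (Suc m)
  let ?f = "f(m := g m)"
  have "urec ?f" using Suc.prems by (intro Suc.IH) (auto simp: le_Suc_eq not_less_eq_eq)
  then have "urec (\<lambda>e. if e = m then f m else ?f e)" by (intro urec_intros)
  moreover have "(\<lambda>e. if e = m then f m else ?f e) = f" by auto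
  ultimately show ?case by simp
qed

subsection \<open>The arithmetical hierarchy\<close>

text \<open>Quantifying existentially over a negated relation of the previous level yields the whole
  alternation, so one recursion suffices and \<open>pi_rel\<close> is complementation.\<close>

primrec sigma_rel :: "nat \<Rightarrow> (nat \<Rightarrow> bool) \<Rightarrow> bool" where
  "sigma_rel 0 P \<longleftrightarrow> decidable P"
| "sigma_rel (Suc n) P \<longleftrightarrow> (\<exists>Q. sigma_rel n Q \<and> (\<forall>e. P e \<longleftrightarrow> (\<exists>y. \<not> Q (npair y e))))"

definition pi_rel :: "nat \<Rightarrow> (nat \<Rightarrow> bool) \<Rightarrow> bool" where
  "pi_rel n P \<longleftrightarrow> sigma_rel n (\<lambda>e. \<not> P e)"

definition delta_rel :: "nat \<Rightarrow> (nat \<Rightarrow> bool) \<Rightarrow> bool" where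
  "delta_rel n P \<longleftrightarrow> sigma_rel n P \<and> pi_rel n P"

lemma sigma_not [urec_intros]: "pi_rel n P \<Longrightarrow> sigma_rel n (\<lambda>e. \<not> P e)"
  by (simp add: pi_rel_def)

lemma pi_not [urec_intros]: "sigma_rel n P \<Longrightarrow> pi_rel n (\<lambda>e. \<not> P e)"
  by (simp add: pi_rel_def)

lemma sigma_subst: "sigma_rel n P \<Longrightarrow> urec f \<Longrightarrow> sigma_rel n (\<lambda>e. P (f e))"
proof (induction n arbitrary: P f)
  case 0
  then show ?case by (simp add: decidable_subst)
next
  case (Suc n)
  then obtain Q where Q: "sigma_rel n Q" "\<And>e. P e \<longleftrightarrow> (\<exists>y. \<not> Q (npair y e))" by auto
  have "sigma_rel n (\<lambda>z. Q (npair (nfst z) (f (nsnd z))))"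
    by (intro Suc.IH[OF Q(1)] urec_intros urec.comp[OF Suc.prems(2)])
  then show ?case using Q(2) by (auto intro!: exI[of _ "\<lambda>z. Q (npair (nfst z) (f (nsnd z)))"])
qed

lemma pi_subst: "pi_rel n P \<Longrightarrow> urec f \<Longrightarrow> pi_rel n (\<lambda>e. P (f e))"
  unfolding pi_rel_def by (rule sigma_subst)

lemma delta_subst: "delta_rel n P \<Longrightarrow> urec f \<Longrightarrow> delta_rel n (\<lambda>e. P (f e))"
  unfolding delta_rel_def by (simp add: sigma_subst pi_subst)

lemma sigma_ex_pi:
  assumes "pi_rel n (\<lambda>z. P (nfst z) (nsnd z))"
  shows "sigma_rel (Suc n) (\<lambda>e. \<exists>y. P y e)"
  using assms unfolding pi_rel_def
  by (auto intro!: exI[of _ "\<lambda>z. \<not> P (nfst z) (nsnd z)"])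

lemma pi_all_sigma:
  assumes "sigma_rel n (\<lambda>z. P (nfst z) (nsnd z))"
  shows "pi_rel (Suc n) (\<lambda>e. \<forall>y. P y e)"
  using assms unfolding pi_rel_def
  by (auto intro!: exI[of _ "\<lambda>z. P (nfst z) (nsnd z)"])

lemma sigma_Suc_E:
  assumes "sigma_rel (Suc n) P"
  obtains Q where "pi_rel n Q" "\<And>e. P e \<longleftrightarrow> (\<exists>y. Q (npair y e))"
proof -
  from assms obtain Q where "sigma_rel n Q" "\<And>e. P e \<longleftrightarrow> (\<exists>y. \<not> Q (npair y e))" by auto
  then show ?thesis by (intro that[of "\<lambda>z. \<not> Q z"]) (auto simp: pi_rel_def)
qed

declare sigma_rel.simps(2) [simp del]

lemma pi_subst2:
  "pi_rel n (\<lambda>z. Q (nfst z) (nsnd z)) \<Longrightarrow> urec f \<Longrightarrow> urec g \<Longrightarrow> pi_rel n (\<lambda>e. Q (f e) (g e))"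
  using pi_subst[of n "\<lambda>z. Q (nfst z) (nsnd z)" "\<lambda>e. npair (f e) (g e)"] by (simp add: urec_npair)

lemma sigma_subst2:
  "sigma_rel n (\<lambda>z. Q (nfst z) (nsnd z)) \<Longrightarrow> urec f \<Longrightarrow> urec g \<Longrightarrow> sigma_rel n (\<lambda>e. Q (f e) (g e))"
  using sigma_subst[of n "\<lambda>z. Q (nfst z) (nsnd z)" "\<lambda>e. npair (f e) (g e)"] by (simp add: urec_npair)

lemma delta_subst2:
  "delta_rel n (\<lambda>z. Q (nfst z) (nsnd z)) \<Longrightarrow> urec f \<Longrightarrow> urec g \<Longrightarrow> delta_rel n (\<lambda>e. Q (f e) (g e))"
  unfolding delta_rel_def by (simp add: sigma_subst2 pi_subst2)

text \<open>Both closures are proved together because complementing the matrix exchanges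
  them.\<close>

lemma sigma_conj_disj:
  "sigma_rel n P \<Longrightarrow> sigma_rel n P' \<Longrightarrow>
    sigma_rel n (\<lambda>e. P e \<and> P' e) \<and> sigma_rel n (\<lambda>e. P e \<or> P' e)"
proof (induction n arbitrary: P P')
  case 0
  then show ?case by (simp add: urec_intros)
next
  case (Suc n)
  from Suc.prems obtain Q Q' where
    Q: "pi_rel n Q" "\<And>e. P e \<longleftrightarrow> (\<exists>y. Q (npair y e))" and
    Q': "pi_rel n Q'" "\<And>e. P' e \<longleftrightarrow> (\<exists>y. Q' (npair y e))"
    by (auto elim!: sigma_Suc_E)
  have "pi_rel n (\<lambda>z. Q (npair (nfst (nfst z)) (nsnd z)) \<and> Q' (npair (nsnd (nfst z)) (nsnd z)))"
    using Suc.IH[of "\<lambda>z. \<not> Q (npair (nfst (nfst z)) (nsnd z))" "\<lambda>z. \<not> Q' (npair (nsnd (nfst z)) (nsnd z))"]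
      pi_subst[OF Q(1), of "\<lambda>z. npair (nfst (nfst z)) (nsnd z)"]
      pi_subst[OF Q'(1), of "\<lambda>z. npair (nsnd (nfst z)) (nsnd z)"]
    by (simp add: pi_rel_def urec_intros)
  \<comment> \<open>A conjunction needs two independent witnesses, packed into one number; a
    disjunction can share one.\<close>
  then have "sigma_rel (Suc n) (\<lambda>e. \<exists>y. Q (npair (nfst y) e) \<and> Q' (npair (nsnd y) e))"
    by (rule sigma_ex_pi)
  moreover have "(\<exists>y. Q (npair (nfst y) e) \<and> Q' (npair (nsnd y) e)) \<longleftrightarrow> P e \<and> P' e" for e
    by (simp add: ex_npair[of "\<lambda>y. Q (npair (nfst y) e) \<and> Q' (npair (nsnd y) e)"] Q(2) Q'(2))
  moreover have "pi_rel n (\<lambda>z. Q z \<or> Q' z)"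
    using Suc.IH[of "\<lambda>z. \<not> Q z" "\<lambda>z. \<not> Q' z"] Q(1) Q'(1)
    by (simp add: pi_rel_def)
  then have "sigma_rel (Suc n) (\<lambda>e. \<exists>y. Q (npair y e) \<or> Q' (npair y e))"
    by (intro sigma_ex_pi) simp
  ultimately show ?case by (simp add: Q(2) Q'(2) ex_disj_distrib)
qed

lemma sigma_conj [urec_intros]:
  "sigma_rel n P \<Longrightarrow> sigma_rel n Q \<Longrightarrow> sigma_rel n (\<lambda>e. P e \<and> Q e)"
  using sigma_conj_disj by blast

lemma sigma_disj [urec_intros]:
  "sigma_rel n P \<Longrightarrow> sigma_rel n Q \<Longrightarrow> sigma_rel n (\<lambda>e. P e \<or> Q e)"
  using sigma_conj_disj by blast

lemma pi_conj [urec_intros]: "pi_rel n P \<Longrightarrow> pi_rel n Q \<Longrightarrow> pi_rel n (\<lambda>e. P e \<and> Q e)"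
  unfolding pi_rel_def de_Morgan_conj by (rule sigma_disj)

lemma pi_disj [urec_intros]: "pi_rel n P \<Longrightarrow> pi_rel n Q \<Longrightarrow> pi_rel n (\<lambda>e. P e \<or> Q e)"
  unfolding pi_rel_def de_Morgan_disj by (rule sigma_conj)

lemma pi_imp [urec_intros]: "sigma_rel n P \<Longrightarrow> pi_rel n Q \<Longrightarrow> pi_rel n (\<lambda>e. P e \<longrightarrow> Q e)"
  unfolding imp_conv_disj by (intro pi_disj pi_not)

text \<open>A vacuous quantifier leads to the other side one level up. To stay on the same side, the
  quantifier is added innermost, where the matrix is decidable and so on both sides.\<close>

lemma
  shows sigma_Suc: "sigma_rel n P \<Longrightarrow> sigma_rel (Suc n) P"
    and pi_Suc: "pi_rel n P \<Longrightarrow> pi_rel (Suc n) P"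
    and sigma_Suc_if_pi: "pi_rel n P \<Longrightarrow> sigma_rel (Suc n) P"
    and pi_Suc_if_sigma: "sigma_rel n P \<Longrightarrow> pi_rel (Suc n) P"
proof -
  show *: "pi_rel n P \<Longrightarrow> sigma_rel (Suc n) P" for P
    using sigma_ex_pi[OF pi_subst[of n P nsnd]] by (simp add: urec_intros)
  show "sigma_rel n P \<Longrightarrow> pi_rel (Suc n) P" for P
    using *[of "\<lambda>e. \<not> P e"] by (simp add: pi_rel_def)
  show **: "sigma_rel n P \<Longrightarrow> sigma_rel (Suc n) P" for P
  proof (induction n arbitrary: P)
    case 0
    then have "pi_rel 0 P" by (simp add: pi_rel_def decidable_not)
    then show ?case using sigma_ex_pi[OF pi_subst[of 0 P nsnd]] by (simp add: urec_intros)
  next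
    case (Suc n)
    then show ?case by (metis sigma_rel.simps(2))
  qed
  show "pi_rel n P \<Longrightarrow> pi_rel (Suc n) P"
    using ** by (simp add: pi_rel_def)
qed

lemma delta_Suc_sigma: "sigma_rel n P \<Longrightarrow> delta_rel (Suc n) P"
  by (simp add: delta_rel_def sigma_Suc pi_Suc_if_sigma)

lemma delta_Suc_pi: "pi_rel n P \<Longrightarrow> delta_rel (Suc n) P"
  by (simp add: delta_rel_def pi_Suc sigma_Suc_if_pi)

lemma sigma_decidable [urec_intros]: "decidable P \<Longrightarrow> sigma_rel n P"
  by (induction n) (auto intro: sigma_Suc)

lemma pi_decidable [urec_intros]: "decidable P \<Longrightarrow> pi_rel n P"
  unfolding pi_rel_def by (intro urec_intros)

lemma delta_not [urec_intros]: "delta_rel n P \<Longrightarrow> delta_rel n (\<lambda>e. \<not> P e)"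
  by (simp add: delta_rel_def sigma_not pi_not)

lemma delta_conj [urec_intros]: "delta_rel n P \<Longrightarrow> delta_rel n Q \<Longrightarrow> delta_rel n (\<lambda>e. P e \<and> Q e)"
  by (simp add: delta_rel_def sigma_conj pi_conj)

lemma delta_disj [urec_intros]: "delta_rel n P \<Longrightarrow> delta_rel n Q \<Longrightarrow> delta_rel n (\<lambda>e. P e \<or> Q e)"
  by (simp add: delta_rel_def sigma_disj pi_disj)

lemma delta_decidable [urec_intros]: "decidable P \<Longrightarrow> delta_rel n P"
  by (simp add: delta_rel_def sigma_decidable pi_decidable)

text \<open>A bounded universal quantifier passes an existential one by collecting the witnesses in
  a coded sequence. As the matrix is complemented, both bounded quantifiers go through the induction
  together.\<close>

lemma sigma_bounded:
  "sigma_rel n (\<lambda>z. P (nfst z) (nsnd z)) \<Longrightarrow> urec f \<Longrightarrow>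
    sigma_rel n (\<lambda>e. \<forall>y<f e. P y e) \<and> sigma_rel n (\<lambda>e. \<exists>y<f e. P y e)"
proof (induction n arbitrary: P f)
  case 0
  then show ?case by (simp add: urec_intros)
next
  case (Suc n)
  from Suc.prems(1) obtain Q where
    Q: "pi_rel n Q" "\<And>e. P (nfst e) (nsnd e) \<longleftrightarrow> (\<exists>v. Q (npair v e))"
    by (rule sigma_Suc_E) blast
  have P: "P y e \<longleftrightarrow> (\<exists>v. Q (npair v (npair y e)))" for y e
    using Q(2)[of "npair y e"] by simp
  have "pi_rel n (\<lambda>w. Q (npair (seq_nth (nfst (nsnd w)) (nfst w)) (npair (nfst w) (nsnd (nsnd w)))))"
    by (intro pi_subst[OF Q(1)] urec_intros)
  then have "pi_rel n (\<lambda>z. \<forall>y<f (nsnd z). Q (npair (seq_nth (nfst z) y) (npair y (nsnd z))))"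
    using Suc.IH[of "\<lambda>y z. \<not> Q (npair (seq_nth (nfst z) y) (npair y (nsnd z)))" "\<lambda>z. f (nsnd z)"]
    by (simp add: pi_rel_def urec_intros urec.comp[OF Suc.prems(2)])
  then have "sigma_rel (Suc n) (\<lambda>e. \<exists>s. \<forall>y<f e. Q (npair (seq_nth s y) (npair y e)))"
    by (rule sigma_ex_pi)
  moreover have "(\<exists>s. \<forall>y<f e. Q (npair (seq_nth s y) (npair y e))) \<longleftrightarrow> (\<forall>y<f e. P y e)" for e
    using ex_seq_choice[of "f e" "\<lambda>y v. Q (npair v (npair y e))"] by (auto simp: P)
  moreover have "pi_rel n (\<lambda>w. Q (npair (nfst (nsnd w)) (npair (nfst w) (nsnd (nsnd w)))))"
    by (intro pi_subst[OF Q(1)] urec_intros)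
  then have "pi_rel n (\<lambda>z. \<exists>y<f (nsnd z). Q (npair (nfst z) (npair y (nsnd z))))"
    using Suc.IH[of "\<lambda>y z. \<not> Q (npair (nfst z) (npair y (nsnd z)))" "\<lambda>z. f (nsnd z)"]
    by (simp add: pi_rel_def urec_intros urec.comp[OF Suc.prems(2)])
  then have "sigma_rel (Suc n) (\<lambda>e. \<exists>v. \<exists>y<f e. Q (npair v (npair y e)))"
    by (rule sigma_ex_pi)
  moreover have "(\<exists>v. \<exists>y<f e. Q (npair v (npair y e))) \<longleftrightarrow> (\<exists>y<f e. P y e)" for e
    by (auto simp: P)
  ultimately show ?case by (simp)
qed

lemma sigma_ball [urec_intros]:
  "sigma_rel n (\<lambda>z. P (nfst z) (nsnd z)) \<Longrightarrow> urec f \<Longrightarrow> sigma_rel n (\<lambda>e. \<forall>y<f e. P y e)"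
  using sigma_bounded by blast

lemma sigma_bex [urec_intros]:
  "sigma_rel n (\<lambda>z. P (nfst z) (nsnd z)) \<Longrightarrow> urec f \<Longrightarrow> sigma_rel n (\<lambda>e. \<exists>y<f e. P y e)"
  using sigma_bounded by blast

lemma pi_ball [urec_intros]:
  "pi_rel n (\<lambda>z. P (nfst z) (nsnd z)) \<Longrightarrow> urec f \<Longrightarrow> pi_rel n (\<lambda>e. \<forall>y<f e. P y e)"
  unfolding pi_rel_def by (simp add: sigma_bex)

lemma pi_bex [urec_intros]:
  "pi_rel n (\<lambda>z. P (nfst z) (nsnd z)) \<Longrightarrow> urec f \<Longrightarrow> pi_rel n (\<lambda>e. \<exists>y<f e. P y e)"
  unfolding pi_rel_def by (simp add: sigma_ball)

lemma delta_ball [urec_intros]: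
  "delta_rel n (\<lambda>z. P (nfst z) (nsnd z)) \<Longrightarrow> urec f \<Longrightarrow> delta_rel n (\<lambda>e. \<forall>y<f e. P y e)"
  by (simp add: delta_rel_def sigma_ball pi_ball)

lemma delta_bex [urec_intros]:
  "delta_rel n (\<lambda>z. P (nfst z) (nsnd z)) \<Longrightarrow> urec f \<Longrightarrow> delta_rel n (\<lambda>e. \<exists>y<f e. P y e)"
  by (simp add: delta_rel_def sigma_bex pi_bex)

text \<open>Two adjacent existential quantifiers contract to one over pair codes.\<close>

lemma sigma_ex:
  assumes "sigma_rel (Suc n) (\<lambda>z. P (nfst z) (nsnd z))"
  shows "sigma_rel (Suc n) (\<lambda>e. \<exists>y. P y e)"
proof -
  from assms obtain Q where
    Q: "pi_rel n Q" "\<And>e. P (nfst e) (nsnd e) \<longleftrightarrow> (\<exists>v. Q (npair v e))"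
    by (rule sigma_Suc_E) blast
  have P: "P y e \<longleftrightarrow> (\<exists>v. Q (npair v (npair y e)))" for y e
    using Q(2)[of "npair y e"] by simp
  have "sigma_rel (Suc n) (\<lambda>e. \<exists>w. Q (npair (nfst w) (npair (nsnd w) e)))"
    by (intro sigma_ex_pi pi_subst[OF Q(1)] urec_intros)
  moreover have "(\<exists>w. Q (npair (nfst w) (npair (nsnd w) e))) \<longleftrightarrow> (\<exists>y. P y e)" for e
    by (subst ex_npair) (auto simp: P)
  ultimately show ?thesis by (simp)
qed

lemma pi_all: "pi_rel (Suc n) (\<lambda>z. P (nfst z) (nsnd z)) \<Longrightarrow> pi_rel (Suc n) (\<lambda>e. \<forall>y. P y e)"
  using sigma_ex[of n "\<lambda>y e. \<not> P y e"] by (simp add: pi_rel_def)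

section \<open>Agreement with the hierarchy on lists\<close>

lemma sigma_pi_tuple_decode:
  "(is_Sigma n k P \<longrightarrow> sigma_rel n (\<lambda>e. P (tuple_decode k e))) \<and>
   (is_Pi n k P \<longrightarrow> pi_rel n (\<lambda>e. P (tuple_decode k e)))"
proof (induction n arbitrary: k P)
  case 0
  have "decidable (\<lambda>e. P (tuple_decode k e))" if P: "computable_rel k P"
  proof -
    obtain F where F: "total_recursive k F" "\<And>xs. length xs = k \<Longrightarrow> F xs = (if P xs then 1 else 0)"
      using P unfolding computable_rel_def by blast
    from urec_if_total_recursive[OF F(1)] show ?thesis
      unfolding decidable_def by (rule urec_cong) (simp add: F(2))
  qed
  then show ?case by (simp add: urec_intros)
next
  case (Suc n)
  show ?case
  proof (intro conjI impI)
    assume "is_Sigma (Suc n) k P"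
    then obtain Q where Q: "is_Pi n (Suc k) Q"
      "\<And>xs. length xs = k \<Longrightarrow> P xs \<longleftrightarrow> (\<exists>y. Q (y # xs))" by auto
    have "sigma_rel (Suc n) (\<lambda>e. \<exists>y. Q (y # tuple_decode k e))"
      using Suc.IH[of "Suc k" Q] Q(1) by (intro sigma_ex_pi) simp
    then show "sigma_rel (Suc n) (\<lambda>e. P (tuple_decode k e))" using Q(2) by simp
  next
    assume "is_Pi (Suc n) k P"
    then obtain Q where Q: "is_Sigma n (Suc k) Q"
      "\<And>xs. length xs = k \<Longrightarrow> P xs \<longleftrightarrow> (\<forall>y. Q (y # xs))" by auto
    have "pi_rel (Suc n) (\<lambda>e. \<forall>y. Q (y # tuple_decode k e))"
      using Suc.IH[of "Suc k" Q] Q(1) by (intro pi_all_sigma) simp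
    then show "pi_rel (Suc n) (\<lambda>e. P (tuple_decode k e))" using Q(2) by simp
  qed
qed

text \<open>Quantifying over \<open>P'\<close> accounts for lists of the wrong length, where its
  values are arbitrary.\<close>

lemma is_Sigma_Pi_tuple_encode:
  "(sigma_rel n P \<longrightarrow> (\<forall>P'. (\<forall>xs. length xs = k \<longrightarrow> P' xs = P (tuple_encode xs)) \<longrightarrow> is_Sigma n k P')) \<and>
   (pi_rel n P \<longrightarrow> (\<forall>P'. (\<forall>xs. length xs = k \<longrightarrow> P' xs = P (tuple_encode xs)) \<longrightarrow> is_Pi n k P'))"
proof (induction n arbitrary: P k)
  case 0
  have "computable_rel k P'"
    if P: "decidable P" and P': "\<forall>xs. length xs = k \<longrightarrow> P' xs = P (tuple_encode xs)" for P P'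
    using trec_if_urec[OF P[unfolded decidable_def] trec_tuple_encode[of k]] P'
    unfolding trec_def computable_rel_def by simp
  then show ?case using decidable_not[of "\<lambda>e. \<not> P e"] by (simp add: pi_rel_def) blast
next
  case (Suc n)
  show ?case
  proof (intro conjI impI allI)
    fix P' assume P: "sigma_rel (Suc n) P" and P': "\<forall>xs. length xs = k \<longrightarrow> P' xs = P (tuple_encode xs)"
    obtain Q where Q: "pi_rel n Q" "\<And>e. P e \<longleftrightarrow> (\<exists>y. Q (npair y e))"
      using P by (rule sigma_Suc_E) blast
    have "is_Pi n (Suc k) (\<lambda>xs. Q (tuple_encode xs))" using Suc.IH[of Q "Suc k"] Q(1) by simp
    moreover have "\<forall>xs. length xs = k \<longrightarrow> P' xs = (\<exists>y. Q (tuple_encode (y # xs)))"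
      using P' Q(2) by simp
    ultimately show "is_Sigma (Suc n) k P'" unfolding is_Sigma.simps(2) by blast
  next
    fix P' assume P: "pi_rel (Suc n) P" and P': "\<forall>xs. length xs = k \<longrightarrow> P' xs = P (tuple_encode xs)"
    obtain Q where Q: "pi_rel n Q" "\<And>e. (\<not> P e) = (\<exists>y. Q (npair y e))"
      using P unfolding pi_rel_def[of "Suc n"] by (rule sigma_Suc_E) blast
    have "is_Sigma n (Suc k) (\<lambda>xs. \<not> Q (tuple_encode xs))" using Suc.IH[of "\<lambda>e. \<not> Q e" "Suc k"] sigma_not[OF Q(1)] by simp
    moreover have "\<forall>xs. length xs = k \<longrightarrow> P' xs = (\<forall>y. \<not> Q (tuple_encode (y # xs)))"
      using P' Q(2) by auto
    ultimately show "is_Pi (Suc n) k P'" unfolding is_Pi.simps(2) by blast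
  qed
qed

lemma is_Sigma_tuple_encode:
  "sigma_rel n P \<Longrightarrow> (\<And>xs. length xs = k \<Longrightarrow> P' xs = P (tuple_encode xs)) \<Longrightarrow> is_Sigma n k P'"
  using is_Sigma_Pi_tuple_encode[of n P k] by simp

lemma is_Pi_tuple_encode:
  "pi_rel n P \<Longrightarrow> (\<And>xs. length xs = k \<Longrightarrow> P' xs = P (tuple_encode xs)) \<Longrightarrow> is_Pi n k P'"
  using is_Sigma_Pi_tuple_encode[of n P k] by simp

lemma Sigma0_iff: "R \<in> Sigma0 n \<longleftrightarrow> sigma_rel n (\<lambda>e. (nfst e, nsnd e) \<in> R)"
proof
  assume "R \<in> Sigma0 n"
  then have "sigma_rel n (\<lambda>e. (nfst e, nfst (nsnd e)) \<in> R)"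
    using sigma_pi_tuple_decode[of n 2 "\<lambda>xs. (xs ! 0, xs ! 1) \<in> R"]
    by (simp add: Sigma0_def numeral_2_eq_2)
  \<comment> \<open>The list \<open>[x, y]\<close> has code \<open>npair x (npair y 0)\<close>; the
    substitution passes to plain pair codes.\<close>
  from sigma_subst[OF this, of "\<lambda>e. npair (nfst e) (npair (nsnd e) 0)"]
  show "sigma_rel n (\<lambda>e. (nfst e, nsnd e) \<in> R)" by (simp add: urec_intros)
next
  assume "sigma_rel n (\<lambda>e. (nfst e, nsnd e) \<in> R)"
  from sigma_subst[OF this, of "\<lambda>e. npair (nfst e) (nfst (nsnd e))"]
  have "sigma_rel n (\<lambda>e. (nfst e, nfst (nsnd e)) \<in> R)" by (simp add: urec_intros)
  then have "is_Sigma n 2 (\<lambda>xs. (xs ! 0, xs ! 1) \<in> R)"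
    by (rule is_Sigma_tuple_encode) (auto elim: length_2E)
  then show "R \<in> Sigma0 n" by (simp add: Sigma0_def)
qed

lemma Pi0_iff: "R \<in> Pi0 n \<longleftrightarrow> pi_rel n (\<lambda>e. (nfst e, nsnd e) \<in> R)"
proof
  assume "R \<in> Pi0 n"
  then have "pi_rel n (\<lambda>e. (nfst e, nfst (nsnd e)) \<in> R)"
    using sigma_pi_tuple_decode[of n 2 "\<lambda>xs. (xs ! 0, xs ! 1) \<in> R"]
    by (simp add: Pi0_def numeral_2_eq_2)
  from pi_subst[OF this, of "\<lambda>e. npair (nfst e) (npair (nsnd e) 0)"]
  show "pi_rel n (\<lambda>e. (nfst e, nsnd e) \<in> R)" by (simp add: urec_intros)
next
  assume "pi_rel n (\<lambda>e. (nfst e, nsnd e) \<in> R)"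
  from pi_subst[OF this, of "\<lambda>e. npair (nfst e) (nfst (nsnd e))"]
  have "pi_rel n (\<lambda>e. (nfst e, nfst (nsnd e)) \<in> R)" by (simp add: urec_intros)
  then have "is_Pi n 2 (\<lambda>xs. (xs ! 0, xs ! 1) \<in> R)"
    by (rule is_Pi_tuple_encode) (auto elim: length_2E)
  then show "R \<in> Pi0 n" by (simp add: Pi0_def)
qed

lemma Delta0_iff: "R \<in> Delta0 n \<longleftrightarrow> delta_rel n (\<lambda>e. (nfst e, nsnd e) \<in> R)"
  by (simp add: Delta0_def delta_rel_def Sigma0_iff Pi0_iff)

subsection \<open>Universal relations\<close>

abbreviation triple :: "nat \<Rightarrow> nat \<Rightarrow> nat \<Rightarrow> nat" where
  "triple c x v \<equiv> npair c (npair x v)"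

text \<open>A triple \<open>(c, x, v)\<close> claims that the function with code \<open>c\<close> has value \<open>v\<close> at \<open>x\<close>; the tag
  \<open>nfst c\<close> runs through the rules of \<^const>\<open>urec\<close>. A finite set of claims, each of which is justified by
  others in the set, serves as a computation. No well-foundedness has to be required, since a claim
  only depends on claims with smaller codes or smaller recursion arguments.\<close>

definition justified :: "nat set \<Rightarrow> nat \<Rightarrow> nat \<Rightarrow> nat \<Rightarrow> bool" where
  "justified S c x v \<longleftrightarrow>
     nfst c = 0 \<and> v = 0 \<or>
     nfst c = 1 \<and> v = Suc x \<or>
     nfst c = 2 \<and> v = nfst x \<or>
     nfst c = 3 \<and> v = nsnd x \<or>
     nfst c = 4 \<and> triple (nfst (nsnd c)) x (nfst v) \<in> S \<and> triple (nsnd (nsnd c)) x (nsnd v) \<in> S \<or>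
     nfst c = 5 \<and> (\<exists>t\<in>S. t = triple (nsnd (nsnd c)) x (nsnd (nsnd t)) \<and>
       triple (nfst (nsnd c)) (nsnd (nsnd t)) v \<in> S) \<or>
     nfst c = 6 \<and> nfst x = 0 \<and> triple (nfst (nsnd c)) (nsnd x) v \<in> S \<or>
     nfst c = 6 \<and> nfst x \<noteq> 0 \<and> (\<exists>t\<in>S. t = triple c (npair (nfst x - 1) (nsnd x)) (nsnd (nsnd t)) \<and>
       triple (nsnd (nsnd c)) (npair (nfst x - 1) (npair (nsnd (nsnd t)) (nsnd x))) v \<in> S) \<or>
     nfst c = 7 \<and> triple (nsnd c) (npair v x) 0 \<in> S \<and>
       (\<forall>z<v. \<exists>t\<in>S. t = triple (nsnd c) (npair z x) (nsnd (nsnd t)) \<and> nsnd (nsnd t) \<noteq> 0)"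

definition computation :: "nat set \<Rightarrow> bool" where
  "computation S \<longleftrightarrow> (\<forall>t\<in>S. justified S (nfst t) (nfst (nsnd t)) (nsnd (nsnd t)))"

lemma computation_justified: "computation S \<Longrightarrow> triple c x v \<in> S \<Longrightarrow> justified S c x v"
  unfolding computation_def by (drule (1) bspec) simp

lemma justified_mono: "justified S c x v \<Longrightarrow> S \<subseteq> T \<Longrightarrow> justified T c x v"
  unfolding justified_def Bex_def by (elim disjE) (simp; blast)+

lemma computation_UN: "(\<And>i. i \<in> I \<Longrightarrow> computation (S i)) \<Longrightarrow> computation (\<Union>i\<in>I. S i)"
  unfolding computation_def by (blast intro: justified_mono)

lemma computation_Un: "computation S \<Longrightarrow> computation T \<Longrightarrow> computation (S \<union> T)"
  unfolding computation_def by (blast intro: justified_mono)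

lemma computation_insert:
  "computation S \<Longrightarrow> justified S c x v \<Longrightarrow> computation (insert (triple c x v) S)"
  unfolding computation_def by (auto intro: justified_mono)

text \<open>Soundness covers arbitrary \<open>S\<close>, so that claims about subroutines can be
  read off any computation containing them. Completeness asks for a finite \<open>S\<close>, which a
  number can code.\<close>

definition codes :: "nat \<Rightarrow> (nat \<Rightarrow> nat) \<Rightarrow> bool" where
  "codes c f \<longleftrightarrow>
    (\<forall>S x v. computation S \<longrightarrow> triple c x v \<in> S \<longrightarrow> v = f x) \<and>
    (\<forall>x. \<exists>S. finite S \<and> computation S \<and> triple c x (f x) \<in> S)"

lemma codes_justified:
  assumes "codes c f" "computation S" "triple c x v \<in> S"
  shows "v = f x"
  using assms unfolding codes_def by blast

lemma codes_ex:
  assumes "codes c f"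
  obtains S where "finite S" "computation S" "triple c x (f x) \<in> S"
  using assms unfolding codes_def by blast

lemma codesI:
  assumes "\<And>S x v. computation S \<Longrightarrow> triple c x v \<in> S \<Longrightarrow> justified S c x v \<Longrightarrow> v = f x"
    and "\<And>x. \<exists>S. finite S \<and> computation S \<and> justified S c x (f x)"
  shows "codes c f"
  unfolding codes_def
proof (intro conjI allI impI)
  fix S x v assume "computation S" "triple c x v \<in> S"
  then show "v = f x" using assms(1) computation_justified by blast
next
  fix x
  show "\<exists>S. finite S \<and> computation S \<and> triple c x (f x) \<in> S"
    using assms(2)[of x] computation_insert by (metis finite_insert insertI1)
qed

lemma codes_basic: "(\<And>S x v. justified S c x v \<longleftrightarrow> v = f x) \<Longrightarrow> codes c f"
  by (rule codesI) (auto simp: computation_def intro: exI[of _ "{}"])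

text \<open>The code stores the rule as its tag together with the codes of the parts. Values are
  forced by reading a justification backwards; conversely, finite computations of the parts are
  united.\<close>

lemma ex_code: "urec f \<Longrightarrow> \<exists>c. codes c f"
proof (induction rule: urec.induct)
  case zero
  have "codes (npair 0 0) (\<lambda>x. 0)"
    by (rule codes_basic) (simp add: justified_def)
  then show ?case ..
next
  case succ
  have "codes (npair 1 0) Suc"
    by (rule codes_basic) (simp add: justified_def)
  then show ?case ..
next
  case first
  have "codes (npair 2 0) nfst"
    by (rule codes_basic) (simp add: justified_def)
  then show ?case ..
next
  case second
  have "codes (npair 3 0) nsnd"
    by (rule codes_basic) (simp add: justified_def)
  then show ?case ..
next
  case (pair f g)
  then obtain a b where a: "codes a f" and b: "codes b g" by blast
  have "codes (npair 4 (npair a b)) (\<lambda>x. npair (f x) (g x))"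
  proof (rule codesI)
    fix S x v assume S: "computation S" and "justified S (npair 4 (npair a b)) x v"
    then have "triple a x (nfst v) \<in> S" "triple b x (nsnd v) \<in> S" by (simp_all add: justified_def)
    then have "nfst v = f x" "nsnd v = g x" using S a b codes_justified by blast+
    then show "v = npair (f x) (g x)" using npair_nfst_nsnd[of v] by simp
  next
    fix x
    obtain S T where "finite S" "computation S" "triple a x (f x) \<in> S"
      "finite T" "computation T" "triple b x (g x) \<in> T"
      using codes_ex[OF a] codes_ex[OF b] by metis
    then show "\<exists>S. finite S \<and> computation S \<and> justified S (npair 4 (npair a b)) x (npair (f x) (g x))"
      by (intro exI[of _ "S \<union> T"]) (simp add: computation_Un justified_def)
  qed
  then show ?case ..
next
  case (comp f g)
  then obtain a b where a: "codes a f" and b: "codes b g" by blast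
  have "codes (npair 5 (npair a b)) (\<lambda>x. f (g x))"
  proof (rule codesI)
    fix S x v assume S: "computation S" and "justified S (npair 5 (npair a b)) x v"
    then obtain w where "triple b x w \<in> S" "triple a w v \<in> S" by (simp add: justified_def) metis
    then show "v = f (g x)" using S a b codes_justified by blast
  next
    fix x
    obtain S T where "finite S" "computation S" "triple b x (g x) \<in> S"
      "finite T" "computation T" "triple a (g x) (f (g x)) \<in> T"
      using codes_ex[OF a] codes_ex[OF b] by metis
    then show "\<exists>S. finite S \<and> computation S \<and> justified S (npair 5 (npair a b)) x (f (g x))"
      by (intro exI[of _ "S \<union> T"]) (auto simp: computation_Un justified_def intro!: bexI[of _ "triple b x (g x)"])
  qed
  then show ?case ..
next
  case (prim_rec f g)
  then obtain a b where a: "codes a f" and b: "codes b g" by blast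
  define h where "h s = rec_nat (f s) (\<lambda>y r. g (npair y (npair r s)))" for s
  let ?c = "npair 6 (npair a b)"
  have "codes ?c (\<lambda>x. h (nsnd x) (nfst x))"
  proof (rule codesI)
    fix S x v assume S: "computation S" and x: "triple ?c x v \<in> S"
    \<comment> \<open>Claims for \<open>?c\<close> refer to \<open>?c\<close> itself, so soundness
      needs its own induction on the recursion argument.\<close>
    have "triple ?c (npair y s) v \<in> S \<Longrightarrow> v = h s y" for y s v
    proof (induction y arbitrary: v)
      case 0
      then have "justified S ?c (npair 0 s) v" using S computation_justified by blast
      then have "triple a s v \<in> S" by (simp add: justified_def)
      then show ?case using codes_justified[OF a S] by (simp add: h_def)
    next
      case (Suc y)
      then have "justified S ?c (npair (Suc y) s) v" using S computation_justified by blast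
      then obtain w where "triple ?c (npair y s) w \<in> S" "triple b (npair y (npair w s)) v \<in> S"
        by (simp add: justified_def) metis
      then show ?case using codes_justified[OF b S] Suc.IH by (simp add: h_def)
    qed
    from this[of "nfst x" "nsnd x" v] x show "v = h (nsnd x) (nfst x)" by simp
  next
    fix x
    have "\<exists>S. finite S \<and> computation S \<and> justified S ?c (npair y s) (h s y)" for y s
    proof (induction y)
      case 0
      obtain S where "finite S" "computation S" "triple a s (f s) \<in> S" using codes_ex[OF a] by metis
      then show ?case by (intro exI[of _ S]) (simp add: justified_def h_def)
    next
      case (Suc y)
      then obtain S where S: "finite S" "computation S" "justified S ?c (npair y s) (h s y)" by blast
      obtain T where T: "finite T" "computation T"
        "triple b (npair y (npair (h s y) s)) (h s (Suc y)) \<in> T"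
        using codes_ex[OF b, of "npair y (npair (h s y) s)"] by (auto simp: h_def)
      have "computation (insert (triple ?c (npair y s) (h s y)) S \<union> T)"
        using S T by (intro computation_Un computation_insert)
      moreover have "justified (insert (triple ?c (npair y s) (h s y)) S \<union> T) ?c (npair (Suc y) s) (h s (Suc y))"
        using T(3) by (simp add: justified_def)
      ultimately show ?case using S T by (intro exI conjI) auto
    qed
    from this[of "nfst x" "nsnd x"]
    show "\<exists>S. finite S \<and> computation S \<and> justified S ?c x (h (nsnd x) (nfst x))" by simp
  qed
  then show ?case unfolding h_def ..
next
  case (minim f)
  then obtain a where a: "codes a f" by blast
  have "codes (npair 7 a) (\<lambda>x. LEAST y. f (npair y x) = 0)"
  proof (rule codesI)
    fix S x v assume S: "computation S" and "justified S (npair 7 a) x v"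
    then have v: "triple a (npair v x) 0 \<in> S" and "\<And>z. z < v \<Longrightarrow> \<exists>w. triple a (npair z x) w \<in> S \<and> w \<noteq> 0"
      by (auto simp: justified_def) metis
    then have "\<And>z. z < v \<Longrightarrow> f (npair z x) \<noteq> 0" using codes_justified[OF a S] by metis
    then have "f (npair y x) = 0 \<Longrightarrow> v \<le> y" for y by (meson leI)
    then show "v = (LEAST y. f (npair y x) = 0)"
      using codes_justified[OF a S v] by (intro Least_equality[symmetric]) simp_all
  next
    fix x
    define v where "v = (LEAST y. f (npair y x) = 0)"
    have "\<exists>y. f (npair y x) = 0" using minim.hyps by blast
    then have v: "f (npair v x) = 0" unfolding v_def by (rule LeastI_ex)
    have below: "f (npair z x) \<noteq> 0" if "z < v" for z
      using not_less_Least that unfolding v_def by blast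
    have "\<forall>x. \<exists>S. finite S \<and> computation S \<and> triple a x (f x) \<in> S"
      using codes_ex[OF a] by blast
    then obtain T where T: "\<And>x. finite (T x)" "\<And>x. computation (T x)" "\<And>x. triple a x (f x) \<in> T x"
      by metis
    \<comment> \<open>This contains the nonzero values below \<open>v\<close> as well as the zero at
      \<open>v\<close>.\<close>
    let ?U = "\<Union>z\<in>{..v}. T (npair z x)"
    have mem: "triple a (npair z x) (f (npair z x)) \<in> ?U" if "z \<le> v" for z
      using T(3) that by blast
    have "\<exists>t\<in>?U. t = triple a (npair z x) (nsnd (nsnd t)) \<and> nsnd (nsnd t) \<noteq> 0" if "z < v" for z
      using that below mem[of z] by (intro bexI[of _ "triple a (npair z x) (f (npair z x))"]) simp_all
    then have "justified ?U (npair 7 a) x v"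
      using mem[of v] v unfolding justified_def by simp
    then show "\<exists>S. finite S \<and> computation S \<and> justified S (npair 7 a) x v"
      using T by (intro exI[of _ ?U]) (simp add: computation_UN)
  qed
  then show ?case ..
qed

text \<open>At level one, the index codes a decision function of the matrix, and a finite
  computation certifies its output \<open>0\<close>: the matrix fails, as \<open>sigma_rel\<close>
  demands. Higher levels quantify over the complement of the previous universal relation.\<close>

lemma sigma_universal:
  "\<exists>W. sigma_rel (Suc n) W \<and> (\<forall>P. sigma_rel (Suc n) P \<longrightarrow> (\<exists>c. \<forall>x. P x \<longleftrightarrow> W (npair c x)))"
proof (induction n)
  case 0
  let ?T = "\<lambda>s c x. computation (seq_set s) \<and> triple c x 0 \<in> seq_set s"
  let ?W = "\<lambda>e. \<exists>y s. ?T s (nfst e) (npair y (nsnd e))"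
  have "sigma_rel (Suc 0) ?W"
    unfolding computation_def justified_def
    by (intro sigma_ex sigma_ex_pi urec_intros)
  moreover have "\<exists>c. \<forall>x. P x \<longleftrightarrow> ?W (npair c x)" if "sigma_rel (Suc 0) P" for P
  proof -
    from that obtain Q where Q: "decidable Q" "\<And>x. P x \<longleftrightarrow> (\<exists>y. \<not> Q (npair y x))"
      by (auto simp: sigma_rel.simps(2))
    define q where "q x = (if Q x then 1 else 0 :: nat)" for x
    obtain c where c: "codes c q" using ex_code[of q] Q(1) unfolding decidable_def q_def by blast
    have "q x = 0 \<longleftrightarrow> (\<exists>s. ?T s c x)" for x
    proof
      assume "q x = 0"
      then obtain S where "finite S" "computation S" "triple c x 0 \<in> S"
        using codes_ex[OF c, of x] by metis
      then show "\<exists>s. ?T s c x" using ex_seq_set by metis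
    qed (use codes_justified[OF c] in metis)
    moreover have "\<not> Q x \<longleftrightarrow> q x = 0" for x by (simp add: q_def)
    ultimately have "P x \<longleftrightarrow> ?W (npair c x)" for x using Q(2) by simp
    then show ?thesis by blast
  qed
  ultimately show ?case by blast
next
  case (Suc n)
  then obtain W where W: "sigma_rel (Suc n) W"
    "\<And>P. sigma_rel (Suc n) P \<Longrightarrow> \<exists>c. \<forall>x. P x \<longleftrightarrow> W (npair c x)" by blast
  let ?W = "\<lambda>e. \<exists>y. \<not> W (npair (nfst e) (npair y (nsnd e)))"
  have "sigma_rel (Suc (Suc n)) ?W"
    by (intro sigma_ex_pi pi_not sigma_subst[OF W(1)] urec_intros)
  moreover have "\<exists>c. \<forall>x. P x \<longleftrightarrow> ?W (npair c x)" if P: "sigma_rel (Suc (Suc n)) P" for P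
  proof -
    obtain Q where Q: "pi_rel (Suc n) Q" "\<And>x. P x \<longleftrightarrow> (\<exists>y. Q (npair y x))"
      using sigma_Suc_E[OF P] by blast
    obtain c where "\<And>x. \<not> Q x \<longleftrightarrow> W (npair c x)" using W(2)[OF sigma_not[OF Q(1)]] by blast
    then have "P x \<longleftrightarrow> ?W (npair c x)" for x using Q(2) by auto
    then show ?thesis by blast
  qed
  ultimately show ?case by blast
qed

text \<open>Diagonalization: the complement of the diagonal differs at \<open>c\<close> from the
  section of the universal relation with index \<open>c\<close>.\<close>

lemma sigma_hierarchy_proper:
  obtains P where "sigma_rel (Suc (Suc n)) P" "\<not> sigma_rel (Suc n) P"
proof -
  obtain W where W: "sigma_rel (Suc n) W"
    "\<And>P. sigma_rel (Suc n) P \<Longrightarrow> \<exists>c. \<forall>x. P x \<longleftrightarrow> W (npair c x)"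
    using sigma_universal by blast
  let ?P = "\<lambda>x. \<not> W (npair x x)"
  have "sigma_rel (Suc (Suc n)) ?P"
    by (intro sigma_Suc_if_pi pi_not sigma_subst[OF W(1)] urec_intros)
  moreover have "\<not> sigma_rel (Suc n) ?P" using W(2)[of ?P] by blast
  ultimately show ?thesis by (rule that)
qed

subsection \<open>Unique witnesses and numberings\<close>

text \<open>Minimality of a witness is only \<open>\<Sigma>\<^sub>m\<^sub>+\<^sub>1\<close>, so the
  new witness also carries a bound on the refutations of smaller candidates. Bounded quantifiers
  over the \<open>\<Pi>\<^sub>m\<close> relation \<open>N\<close> keep this condition
  \<open>\<Delta>\<^sub>m\<^sub>+\<^sub>1\<close>.\<close>

lemma sigma_Suc_unique_witness:
  assumes "sigma_rel (Suc (Suc m)) A"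
  obtains B where "pi_rel (Suc m) B" "\<And>x. A x \<longleftrightarrow> (\<exists>w. B (npair w x))"
    "\<And>w w' x. B (npair w x) \<Longrightarrow> B (npair w' x) \<Longrightarrow> w = w'"
proof -
  obtain Q where Q: "pi_rel (Suc m) Q" "\<And>x. A x \<longleftrightarrow> (\<exists>w. Q (npair w x))"
    using assms by (rule sigma_Suc_E) blast
  obtain N where N: "pi_rel m N" "\<And>z. \<not> Q z \<longleftrightarrow> (\<exists>v. N (npair v z))"
    using sigma_not[OF Q(1)] by (rule sigma_Suc_E) blast
  \<comment> \<open>\<open>H v u x\<close>: the bound \<open>v\<close> suffices to refute all candidates below \<open>u\<close>. The unique witness
    pairs the least \<open>u\<close> such that \<open>Q (npair u x)\<close> with the least such bound \<open>v\<close>.\<close>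
  define H where "H v u x \<longleftrightarrow> (\<forall>u'<u. \<exists>v'<v. N (npair v' (npair u' x)))" for v u x
  define B where "B z = (Q (npair (nfst (nfst z)) (nsnd z)) \<and>
    H (nsnd (nfst z)) (nfst (nfst z)) (nsnd z) \<and>
    (\<forall>v<nsnd (nfst z). \<not> H v (nfst (nfst z)) (nsnd z)))" for z
  have "pi_rel (Suc m) B"
    unfolding B_def H_def
    by (intro urec_intros pi_subst[OF Q(1)] pi_subst[OF pi_Suc[OF N(1)]]
        sigma_subst[OF sigma_Suc_if_pi[OF N(1)]])
  moreover have "A x \<longleftrightarrow> (\<exists>w. B (npair w x))" for x
  proof
    assume "A x"
    define u where "u = (LEAST u. Q (npair u x))"
    have "\<exists>u. Q (npair u x)" using \<open>A x\<close> Q(2) by blast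
    then have u: "Q (npair u x)" unfolding u_def by (rule LeastI_ex)
    have below: "\<not> Q (npair u' x)" if "u' < u" for u'
      using not_less_Least that unfolding u_def by blast
    have "\<forall>u'. u' < u \<longrightarrow> (\<exists>v. N (npair v (npair u' x)))"
      using below N(2) by blast
    then obtain g where g: "\<And>u'. u' < u \<Longrightarrow> N (npair (g u') (npair u' x))"
      by metis
    \<comment> \<open>The finitely many refutations have a maximum; \<open>Suc\<close> makes the
      bound strict.\<close>
    have "H (Suc (Max (g ` {..<u}))) u x"
      unfolding H_def using g by (auto intro!: exI[of _ "g _"] simp: less_Suc_eq_le)
    define v where "v = (LEAST v. H v u x)"
    have "H v u x" unfolding v_def by (rule LeastI) fact
    moreover have "\<not> H v' u x" if "v' < v" for v'
      using not_less_Least that unfolding v_def by blast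
    ultimately have "B (npair (npair u v) x)" using u by (simp add: B_def)
    then show "\<exists>w. B (npair w x)" ..
  qed (use Q(2) in \<open>auto simp: B_def\<close>)
  moreover have "w = w'" if B: "B (npair w x)" "B (npair w' x)" for w w' x
  proof -
    \<comment> \<open>If smaller, \<open>nfst w'\<close> would be among the candidates that
      \<open>w\<close> certifies as refuted, whereas \<open>B (npair w' x)\<close> asserts
      \<open>Q\<close> for it.\<close>
    have le: "\<not> nfst w' < nfst w" if "B (npair w x)" "B (npair w' x)" for w w'
      using that N(2)[of "npair (nfst w') x"] by (auto simp: B_def H_def)
    then have eq: "nfst w = nfst w'" using B by (meson linorder_neqE_nat)
    have "\<not> nsnd w' < nsnd w" "\<not> nsnd w < nsnd w'"
      using B eq by (auto simp: B_def)
    then show ?thesis using eq by (metis npair_nfst_nsnd linorder_neqE_nat)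
  qed
  ultimately show ?thesis by (rule that)
qed

text \<open>The characteristic sequence of \<open>E\<close> below the bound is guessed and checked,
  which is \<open>\<Sigma>\<close> because \<open>E\<close> and its complement both are; counting
  along a coded sequence is recursive.\<close>

lemma delta_card:
  assumes E: "delta_rel (Suc m) (\<lambda>z. E (nfst z) (nsnd z))"
    and b: "urec b" and i: "urec i"
  shows "delta_rel (Suc m) (\<lambda>e. card {z. z < b e \<and> E z e} = i e)"
proof -
  define cnt where "cnt s n = rec_nat 0 (\<lambda>z r. if seq_nth s z \<noteq> 0 then Suc r else r) n" for s n
  have cnt: "cnt s n = card {z. z < n \<and> seq_nth s z \<noteq> 0}" for s n
  proof (induction n)
    case (Suc n)
    have "{z. z < Suc n \<and> seq_nth s z \<noteq> 0} =
      (if seq_nth s n \<noteq> 0 then insert n {z. z < n \<and> seq_nth s z \<noteq> 0} else {z. z < n \<and> seq_nth s z \<noteq> 0})"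
      by (auto simp: less_Suc_eq)
    then show ?case using Suc by (simp add: cnt_def)
  qed (simp add: cnt_def)
  have [urec_intros]: "urec (\<lambda>e. cnt (f e) (g e))" if "urec f" "urec g" for f g
    unfolding cnt_def
    by (intro urec_rec_nat urec_intros urec.comp[OF that(1)] that(2))
  note E' = E[unfolded delta_rel_def]
  have eq: "(\<exists>s. cnt s (b e) = j \<and>
      (\<forall>z<b e. seq_nth s z \<noteq> 0 \<and> E z e \<or> \<not> seq_nth s z \<noteq> 0 \<and> \<not> E z e)) \<longleftrightarrow>
      card {z. z < b e \<and> E z e} = j" (is "?L e j \<longleftrightarrow> ?R e j") for e j
  proof
    assume "?L e j"
    then obtain s where s: "cnt s (b e) = j" "\<forall>z<b e. seq_nth s z \<noteq> 0 \<longleftrightarrow> E z e" by blast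
    then have "{z. z < b e \<and> E z e} = {z. z < b e \<and> seq_nth s z \<noteq> 0}" by blast
    then show "?R e j" using s(1) by (simp add: cnt)
  next
    assume R: "?R e j"
    obtain s where s: "\<forall>z<b e. seq_nth s z = (if E z e then 1 else 0)"
      using ex_seq[of "b e" "\<lambda>z. if E z e then 1 else 0"] by blast
    then have "{z. z < b e \<and> E z e} = {z. z < b e \<and> seq_nth s z \<noteq> 0}"
      by (auto split: if_splits)
    then have "cnt s (b e) = j" using R by (simp add: cnt)
    then show "?L e j" using s by (intro exI[of _ s]) auto
  qed
  have "sigma_rel (Suc m) (\<lambda>w. ?L (nsnd w) (nfst w))"
    by (intro sigma_ex urec_intros urec.comp[OF b]
        sigma_subst2[OF conjunct1[OF E']] pi_subst2[OF conjunct2[OF E']])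
  then have sigma: "sigma_rel (Suc m) (\<lambda>w. card {z. z < b (nsnd w) \<and> E z (nsnd w)} = nfst w)"
    unfolding eq .
  \<comment> \<open>The cardinality is a single number, so it differs from \<open>i e\<close> if and
    only if it equals some other \<open>j\<close>.\<close>
  have "sigma_rel (Suc m) (\<lambda>e. \<exists>j. j \<noteq> i e \<and> card {z. z < b e \<and> E z e} = j)"
    by (intro sigma_ex urec_intros urec.comp[OF i] sigma)
  then have "sigma_rel (Suc m) (\<lambda>e. card {z. z < b e \<and> E z e} \<noteq> i e)"
    by simp
  moreover have "sigma_rel (Suc m) (\<lambda>e. card {z. z < b e \<and> E z e} = i e)"
    using sigma_subst[OF sigma, of "\<lambda>e. npair (i e) e"] i by (simp add: urec_intros)
  ultimately show ?thesis by (simp add: delta_rel_def pi_rel_def)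
qed

text \<open>Counting predecessors inverts \<open>enumerate\<close>, and \<open>delta_card\<close>
  bounds the complexity of such counts.\<close>

lemma bij_betw_rank:
  fixes X :: "nat set"
  assumes "infinite X"
  shows "bij_betw (\<lambda>x. card {z. z < x \<and> z \<in> X}) X UNIV"
proof -
  have "card {z. z < enumerate X i \<and> z \<in> X} = i" for i
  proof -
    have "{z. z < enumerate X i \<and> z \<in> X} = enumerate X ` {..<i}"
    proof (intro equalityI subsetI)
      fix z assume z: "z \<in> {z. z < enumerate X i \<and> z \<in> X}"
      then obtain j where "z = enumerate X j" using enumerate_Ex[OF assms] by blast
      then show "z \<in> enumerate X ` {..<i}" using z assms by auto
    qed (use assms enumerate_in_set in auto)
    then show ?thesis using inj_enumerate[OF assms] by (simp add: card_image inj_on_subset)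
  qed
  then show ?thesis
    using enumerate_in_set[OF assms]
    by (intro bij_betw_byWitness[where f' = "enumerate X"]) (auto dest!: enumerate_Ex[OF assms])
qed

text \<open>Counting needs a \<open>\<Delta>\<close> set, whereas \<open>J\<close> is only
  \<open>\<Sigma>\<close>. Pairing each element with its least certificate gives a
  \<open>\<Delta>\<close> set in bijection with \<open>J\<close>, and ranks in that set number
  \<open>J\<close>.\<close>

lemma infinite_sigma_numbering:
  assumes J: "sigma_rel (Suc m) J" and inf: "infinite {a. J a}"
  obtains \<rho> :: "nat \<Rightarrow> nat" where "bij_betw \<rho> {a. J a} UNIV"
    "delta_rel (Suc m) (\<lambda>e. J (nfst e) \<and> \<rho> (nfst e) = nsnd e)"
proof -
  obtain N where N: "pi_rel m N" "\<And>a. J a \<longleftrightarrow> (\<exists>v. N (npair v a))"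
    using J by (rule sigma_Suc_E) blast
  define E where "E z \<longleftrightarrow> N z \<and> (\<forall>v<nfst z. \<not> N (npair v (nsnd z)))" for z
  have E: "delta_rel (Suc m) E"
    unfolding E_def by (intro urec_intros delta_subst[OF delta_Suc_pi[OF N(1)]])
  have ex: "J a \<longleftrightarrow> (\<exists>v. E (npair v a))" for a
  proof
    assume "J a"
    then have "\<exists>v. N (npair v a)" by (simp add: N(2))
    then obtain v where "N (npair v a)" "\<forall>v'<v. \<not> N (npair v' a)"
      using exists_least_iff[of "\<lambda>v. N (npair v a)"] by blast
    then show "\<exists>v. E (npair v a)" by (auto simp: E_def)
  qed (auto simp: E_def N(2))
  have bij: "bij_betw nsnd {z. E z} {a. J a}"
    unfolding bij_betw_def
  proof
    show "inj_on nsnd {z. E z}"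
    proof (rule inj_onI)
      fix z z' assume *: "z \<in> {z. E z}" "z' \<in> {z. E z}" "nsnd z = nsnd z'"
      then have "\<not> nfst z < nfst z'" "\<not> nfst z' < nfst z"
        by (auto simp: E_def) (metis npair_nfst_nsnd)+
      then show "z = z'" using *(3) by (metis npair_nfst_nsnd linorder_neqE_nat)
    qed
    show "nsnd ` {z. E z} = {a. J a}"
      by (auto simp: ex image_iff) (metis npair_nfst_nsnd, metis nsnd_npair)
  qed
  then have "infinite {z. E z}" using inf bij_betw_finite by blast
  from bij_betw_rank[OF this]
  have rank: "bij_betw (\<lambda>z. card {y. y < z \<and> E y}) {z. E z} UNIV" by simp
  define \<rho> where "\<rho> = (\<lambda>z. card {y. y < z \<and> E y}) \<circ> inv_into {z. E z} nsnd"
  have \<rho>: "bij_betw \<rho> {a. J a} UNIV"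
    unfolding \<rho>_def by (rule bij_betw_trans[OF bij_betw_inv_into[OF bij] rank])
  have \<rho>_eq: "\<rho> (nsnd z) = card {y. y < z \<and> E y}" if "E z" for z
    unfolding \<rho>_def using bij_betw_inv_into_left[OF bij, of z] that by simp
  have "delta_rel (Suc m) (\<lambda>z. E (npair (nfst z) (nfst (nsnd z))) \<and>
      card {y. y < npair (nfst z) (nfst (nsnd z)) \<and> E y} = nsnd (nsnd z))"
    by (intro urec_intros delta_card delta_subst[OF E])
  then have "sigma_rel (Suc m) (\<lambda>e. \<exists>v. E (npair v (nfst e)) \<and>
      card {y. y < npair v (nfst e) \<and> E y} = nsnd e)"
    unfolding delta_rel_def by (intro sigma_ex) (rule conjunct1)
  moreover have "(\<exists>v. E (npair v a) \<and> card {y. y < npair v a \<and> E y} = i) \<longleftrightarrow> J a \<and> \<rho> a = i" for a i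
    using \<rho>_eq[of "npair _ a"] by (auto simp: ex)
  ultimately have sigma: "sigma_rel (Suc m) (\<lambda>e. J (nfst e) \<and> \<rho> (nfst e) = nsnd e)"
    by simp
  \<comment> \<open>Each number belongs to exactly one element of \<open>J\<close>, so the
    complement of the graph says that another element has this number.\<close>
  have "sigma_rel (Suc m) (\<lambda>e. \<exists>a. a \<noteq> nfst e \<and> J a \<and> \<rho> a = nsnd e)"
  proof (rule sigma_ex, rule sigma_conj[OF sigma_decidable])
    show "sigma_rel (Suc m) (\<lambda>z. J (nfst z) \<and> \<rho> (nfst z) = nsnd (nsnd z))"
      using sigma_subst[OF sigma, of "\<lambda>z. npair (nfst z) (nsnd (nsnd z))"] by (simp add: urec_intros)
  qed (intro urec_intros)
  moreover have "(\<exists>a'. a' \<noteq> a \<and> J a' \<and> \<rho> a' = i) \<longleftrightarrow> \<not> (J a \<and> \<rho> a = i)" for a i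
  proof -
    have "i \<in> \<rho> ` {a. J a}" using \<rho> by (simp add: bij_betw_def)
    then obtain b where b: "J b" "\<rho> b = i" by blast
    moreover have "a' = b" if "J a'" "\<rho> a' = i" for a'
      using inj_onD[OF bij_betw_imp_inj_on[OF \<rho>], of a' b] that b by simp
    ultimately show ?thesis by metis
  qed
  ultimately have "pi_rel (Suc m) (\<lambda>e. J (nfst e) \<and> \<rho> (nfst e) = nsnd e)"
    by (simp add: pi_rel_def)
  with sigma \<rho> show ?thesis by (intro that) (simp_all add: delta_rel_def)
qed

subsection \<open>Equivalence structures\<close>

lemma isomorphic_sym: "isomorphic R S \<Longrightarrow> isomorphic S R"
  unfolding isomorphic_def
proof (elim exE conjE)
  fix f :: "nat \<Rightarrow> nat" assume f: "bij f" "\<forall>x y. (x, y) \<in> R \<longleftrightarrow> (f x, f y) \<in> S"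
  then show "\<exists>f. bij f \<and> (\<forall>x y. (x, y) \<in> S \<longleftrightarrow> (f x, f y) \<in> R)"
    by (intro exI[of _ "inv f"]) (simp add: bij_imp_bij_inv bij_is_surj surj_f_inv_f)
qed

lemma isomorphic_trans: "isomorphic R S \<Longrightarrow> isomorphic S T \<Longrightarrow> isomorphic R T"
  unfolding isomorphic_def
proof (elim exE conjE)
  fix f g :: "nat \<Rightarrow> nat"
  assume "bij f" "\<forall>x y. (x, y) \<in> R \<longleftrightarrow> (f x, f y) \<in> S" "bij g" "\<forall>x y. (x, y) \<in> S \<longleftrightarrow> (g x, g y) \<in> T"
  then show "\<exists>f. bij f \<and> (\<forall>x y. (x, y) \<in> R \<longleftrightarrow> (f x, f y) \<in> T)"
    by (intro exI[of _ "g \<circ> f"]) (simp add: bij_comp)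
qed

lemma iso_type_eq_iff: "iso_type R = iso_type S \<longleftrightarrow> isomorphic R S"
proof
  assume "iso_type R = iso_type S"
  moreover have "isomorphic S S" unfolding isomorphic_def by (intro exI[of _ id]) simp
  ultimately show "isomorphic R S" unfolding iso_type_def by blast
next
  assume "isomorphic R S"
  then show "iso_type R = iso_type S"
    unfolding iso_type_def using isomorphic_sym isomorphic_trans by blast
qed

lemma IsoType_subset_iff:
  "IsoType K \<Gamma> \<subseteq> IsoType K \<Delta> \<longleftrightarrow> (\<forall>R\<in>K \<inter> \<Gamma>. \<exists>S\<in>K \<inter> \<Delta>. isomorphic R S)"
proof
  assume sub: "IsoType K \<Gamma> \<subseteq> IsoType K \<Delta>"
  show "\<forall>R\<in>K \<inter> \<Gamma>. \<exists>S\<in>K \<inter> \<Delta>. isomorphic R S"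
  proof
    fix R assume "R \<in> K \<inter> \<Gamma>"
    then have "iso_type R \<in> IsoType K \<Delta>" using sub by (auto simp: IsoType_def)
    then show "\<exists>S\<in>K \<inter> \<Delta>. isomorphic R S" by (auto simp: IsoType_def iso_type_eq_iff)
  qed
next
  assume "\<forall>R\<in>K \<inter> \<Gamma>. \<exists>S\<in>K \<inter> \<Delta>. isomorphic R S"
  then show "IsoType K \<Gamma> \<subseteq> IsoType K \<Delta>"
    by (simp add: IsoType_def image_iff iso_type_eq_iff image_subset_iff)
qed

section \<open>Copies in \<open>\<Pi>\<^sub>n\<close> of
  \<open>\<Delta>\<^sub>n\<^sub>+\<^sub>1\<close> structures\<close>

lemma kernel_in_EQ: "{(a, b). L a = L b} \<in> EQ"
  by (auto simp: EQ_def equiv_def refl_on_def sym_def trans_def)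

text \<open>\<open>R\<close> and its copy are the kernels of the labellings \<open>idx\<close> and
  \<open>L\<close>, so the isomorphism only has to be a bijection that matches labels.\<close>

lemma delta_infinite_classes_pi_copy:
  assumes R: "equiv UNIV R" and delta: "R \<in> Delta0 (Suc (Suc m))" and inf: "infinite (UNIV // R)"
  obtains S where "S \<in> EQ" "S \<in> Pi0 (Suc m)" "isomorphic R S"
proof -
  define rep where "rep y \<longleftrightarrow> (\<forall>x<y. (x, y) \<notin> R)" for y
  define least where "least y = (LEAST x. (x, y) \<in> R)" for y
  define rank where "rank x = card {z. z < x \<and> rep z}" for x
  have R_refl: "(x, x) \<in> R" for x using R by (simp add: equiv_def refl_on_def)
  have R_sym: "(x, y) \<in> R \<Longrightarrow> (y, x) \<in> R" for x y using R by (meson equiv_def symE)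
  have R_trans: "(x, y) \<in> R \<Longrightarrow> (y, z) \<in> R \<Longrightarrow> (x, z) \<in> R" for x y z using R by (meson equiv_def transE)
  have least_R: "(least y, y) \<in> R" for y
    unfolding least_def using R_refl by (rule LeastI)
  have least_le: "(x, y) \<in> R \<Longrightarrow> least y \<le> x" for x y
    unfolding least_def by (rule Least_le)
  have rep_least: "rep (least y)" for y
    unfolding rep_def using least_R least_le R_trans by (meson not_less)
  have rep_unique: "x = y" if "rep x" "rep y" "(x, y) \<in> R" for x y
    using that R_sym unfolding rep_def by (meson linorder_neqE_nat)
  have least_rep: "least y = x" if "rep x" "(x, y) \<in> R" for x y
    using rep_unique[OF that(1) rep_least] that(2) R_trans R_sym least_R by metis
  have "UNIV // R = (\<lambda>y. R `` {y}) ` {y. rep y}"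
  proof (intro equalityI subsetI)
    fix c assume "c \<in> UNIV // R"
    then obtain y where "c = R `` {y}" by (rule quotientE)
    then have "c = R `` {least y}" using equiv_class_eq[OF R least_R] by simp
    then show "c \<in> (\<lambda>y. R `` {y}) ` {y. rep y}" using rep_least by blast
  qed (auto simp: quotientI)
  then have inf_rep: "infinite {y. rep y}" using inf by (metis finite_imageI)
  have rank: "bij_betw rank {y. rep y} UNIV"
    using bij_betw_rank[OF inf_rep] unfolding rank_def by simp
  define idx where "idx y = rank (least y)" for y
  have idx_eq: "idx x = idx y \<longleftrightarrow> (x, y) \<in> R" for x y
  proof
    assume "idx x = idx y"
    then have "least x = least y" using rank rep_least by (auto simp: idx_def bij_betw_def dest: inj_onD)
    then show "(x, y) \<in> R" using least_R R_sym R_trans by metis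
  next
    assume "(x, y) \<in> R"
    then show "idx x = idx y" using least_rep[OF rep_least, of x y] least_R R_trans
      by (metis idx_def)
  qed
  note delta' = delta[unfolded Delta0_iff]
  \<comment> \<open>Here \<open>x\<close> is the least element of the class. Requiring it strictly
    below \<open>nfst z\<close> excludes the least elements themselves, and the bound keeps
    \<open>A\<close> in \<open>\<Delta>\<^sub>m\<^sub>+\<^sub>2\<close>.\<close>
  define A where "A z \<longleftrightarrow> (\<exists>x<nfst z. (x, nfst z) \<in> R \<and> rep x \<and> rank x = nsnd z)" for z
  have "delta_rel (Suc (Suc m)) A"
    unfolding A_def rep_def rank_def
    by (intro urec_intros delta_card delta_subst2[of _ "\<lambda>x y. (x, y) \<in> R", OF delta'])
  then have sigma_A: "sigma_rel (Suc (Suc m)) A" by (simp add: delta_rel_def)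
  have A_iff: "A (npair y i) \<longleftrightarrow> \<not> rep y \<and> idx y = i" for y i
  proof
    assume "A (npair y i)"
    then obtain x where "x < y" "(x, y) \<in> R" "rep x" "rank x = i" by (auto simp: A_def)
    then show "\<not> rep y \<and> idx y = i" using least_rep by (auto simp: idx_def rep_def)
  next
    assume *: "\<not> rep y \<and> idx y = i"
    then have "least y < y" using least_le[OF R_refl] rep_least by (metis order_le_less)
    then show "A (npair y i)" using least_R rep_least * by (auto simp: A_def idx_def)
  qed
  obtain B where B: "pi_rel (Suc m) B" "\<And>x. A x \<longleftrightarrow> (\<exists>w. B (npair w x))"
    "\<And>w w' x. B (npair w x) \<Longrightarrow> B (npair w' x) \<Longrightarrow> w = w'"
    using sigma_Suc_unique_witness[OF sigma_A] by blast
  \<comment> \<open>The number \<open>0\<close> is least in its class, so all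
    \<open>npair w (npair 0 0)\<close> lie outside \<open>B\<close>.\<close>
  have "\<not> A (npair 0 0)" by (simp add: A_def)
  then have "\<not> B (npair w (npair 0 0))" for w using B(2) by blast
  then have "range (\<lambda>w. npair w (npair 0 0)) \<subseteq> {a. \<not> B a}" by blast
  moreover have "infinite (range (\<lambda>w. npair w (npair 0 0)))"
    by (intro range_inj_infinite) (simp add: inj_def)
  ultimately have "infinite {a. \<not> B a}" using finite_subset by blast
  then obtain \<rho> where \<rho>: "bij_betw \<rho> {a. \<not> B a} UNIV"
    "delta_rel (Suc m) (\<lambda>e. \<not> B (nfst e) \<and> \<rho> (nfst e) = nsnd e)"
    using infinite_sigma_numbering[OF sigma_not[OF B(1)]] by blast
  define L where "L a = (if B a then nsnd (nsnd a) else \<rho> a)" for a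
  define S where "S = {(a, b). L a = L b}"
  \<comment> \<open>The \<open>\<Sigma>\<close> condition \<open>\<not> B\<close> must not stand
    alone. Outside \<open>B\<close> equal labels mean equal numbers, as \<open>\<rho>\<close> is
    injective; in the mixed cases \<open>\<not> B\<close> is absorbed by the \<open>\<Delta>\<close>
    graph of \<open>\<rho>\<close>.\<close>
  have S_iff: "(a, b) \<in> S \<longleftrightarrow> a = b \<or> (B a \<and> B b \<and> nsnd (nsnd a) = nsnd (nsnd b)) \<or>
      (B a \<and> (\<not> B b \<and> \<rho> b = nsnd (nsnd a))) \<or> (B b \<and> (\<not> B a \<and> \<rho> a = nsnd (nsnd b)))" for a b
  proof -
    have "\<not> B a \<Longrightarrow> \<not> B b \<Longrightarrow> \<rho> a = \<rho> b \<longleftrightarrow> a = b"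
      using \<rho>(1) by (auto simp: bij_betw_def inj_on_def)
    then show ?thesis by (auto simp: S_def L_def)
  qed
  have num: "pi_rel (Suc m) (\<lambda>e. \<not> B (f e) \<and> \<rho> (f e) = g e)" if "urec f" "urec g" for f g
    using pi_subst[OF conjunct2[OF \<rho>(2)[unfolded delta_rel_def]] urec_npair[OF that]] by simp
  have "pi_rel (Suc m) (\<lambda>e. (nfst e, nsnd e) \<in> S)"
    unfolding S_iff
    by (rule pi_disj[OF _ pi_disj[OF _ pi_disj]];
        (rule pi_conj num pi_decidable pi_subst[OF B(1)] | intro urec_intros)+)
  then have "S \<in> Pi0 (Suc m)" by (simp add: Pi0_iff)
  moreover define w where "w y = (SOME w. B (npair w (npair y (idx y))))" for y
  have w: "B (npair (w y) (npair y (idx y)))" if "\<not> rep y" for y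
    unfolding w_def using that A_iff B(2) by (intro someI_ex[of "\<lambda>w. B (npair w (npair y (idx y)))"]) blast
  define f where "f y = (if rep y then inv_into {a. \<not> B a} \<rho> (idx y) else npair (w y) (npair y (idx y)))" for y
  have f_rep: "\<not> B (f y)" "\<rho> (f y) = idx y" if "rep y" for y
    using that \<rho>(1) inv_into_into[of "idx y" \<rho> "{a. \<not> B a}"] f_inv_into_f[of "idx y" \<rho> "{a. \<not> B a}"]
    by (auto simp: f_def bij_betw_def)
  have f_nonrep: "B (f y)" "f y = npair (w y) (npair y (idx y))" if "\<not> rep y" for y
    using that w by (auto simp: f_def)
  have L_f: "L (f y) = idx y" for y
    using f_rep f_nonrep by (cases "rep y") (auto simp: L_def)
  have "isomorphic R S"
    unfolding isomorphic_def
  proof (intro exI conjI allI)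
    have "inj f"
    proof (rule injI)
      fix x y assume eq: "f x = f y"
      then have "rep x \<longleftrightarrow> rep y" using f_rep(1) f_nonrep(1) by metis
      moreover have "(x, y) \<in> R" using L_f eq idx_eq by metis
      ultimately show "x = y"
        using rep_unique f_nonrep(2) eq by (metis nfst_npair nsnd_npair)
    qed
    moreover have "\<exists>y. f y = a" for a
    proof (cases "B a")
      case True
      define y where "y = nfst (nsnd a)"
      have a: "a = npair (nfst a) (npair y (nsnd (nsnd a)))" by (simp add: y_def)
      then have "A (npair y (nsnd (nsnd a)))" using True B(2) by metis
      then have "\<not> rep y" "idx y = nsnd (nsnd a)" by (simp_all add: A_iff)
      \<comment> \<open>Both have the tail \<open>npair y (idx y)\<close>, and the witness in front
        of it is unique.\<close>
      then have "f y = a" using a B(3) True f_nonrep by metis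
      then show ?thesis ..
    next
      case False
      obtain y where y: "rep y" "rank y = \<rho> a" using rank unfolding bij_betw_def by (metis UNIV_I imageE mem_Collect_eq)
      then have "idx y = \<rho> a" using least_rep R_refl by (simp add: idx_def)
      then have "f y = a" using False y(1) bij_betw_inv_into_left[OF \<rho>(1), of a] by (simp add: f_def)
      then show ?thesis ..
    qed
    ultimately show "bij f" by (metis bijI surjI surj_def)
  next
    fix x y show "((x, y) \<in> R) = ((f x, f y) \<in> S)" by (simp add: S_def L_f idx_eq)
  qed
  moreover have "S \<in> EQ" unfolding S_def by (rule kernel_in_EQ)
  ultimately show ?thesis using that by blast
qed

lemma ex_bij_betw_infinite_nat_sets:
  fixes X Y :: "nat set"
  assumes "infinite X" "infinite Y"
  shows "\<exists>h. bij_betw h X Y"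
  using bij_betw_trans[OF bij_betw_inv_into[OF bij_enumerate[OF assms(1)]] bij_enumerate[OF assms(2)]]
  by blast

text \<open>The finite classes together fill an initial segment of length \<open>k\<close>; above
  it, the \<open>p\<close> infinite classes become the residue classes modulo \<open>p\<close>.
  Labels are then read from finite tables.\<close>

lemma finite_classes_computable_copy:
  assumes R: "equiv UNIV R" and fin: "finite (UNIV // R)"
  obtains S where "S \<in> EQ" "S \<in> Pi0 n" "isomorphic R S"
proof -
  let ?c = "\<lambda>x. R `` {x}"
  define I where "I = {c \<in> UNIV // R. infinite c}"
  define A where "A = {x. finite (?c x)}"
  have class_in: "?c x \<in> UNIV // R" for x by (simp add: quotientI)
  have self: "x \<in> ?c x" for x using R by (simp add: equiv_def refl_on_def)
  have "A \<subseteq> \<Union>(UNIV // R - I)" unfolding A_def I_def using class_in self by fast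
  moreover have "finite (\<Union>(UNIV // R - I))" using fin by (auto simp: I_def)
  ultimately have "finite A" by (rule finite_subset)
  \<comment> \<open>Finitely many finite classes do not exhaust the natural numbers, so an infinite
    class exists and the modulus \<open>p\<close> is positive.\<close>
  then have "A \<noteq> UNIV" by auto
  then have "I \<noteq> {}" unfolding A_def I_def using class_in by fastforce
  have "finite I" using fin by (simp add: I_def)
  define p where "p = card I"
  define k where "k = card A"
  have "p > 0" using \<open>I \<noteq> {}\<close> \<open>finite I\<close> by (simp add: p_def card_gt_0_iff)
  obtain num where num: "bij_betw num I {..<p}"
    using ex_bij_betw_finite_nat[OF \<open>finite I\<close>] by (auto simp: p_def lessThan_atLeast0)
  obtain g where g: "bij_betw g A {..<k}"
    using ex_bij_betw_finite_nat[OF \<open>finite A\<close>] by (auto simp: k_def lessThan_atLeast0)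
  obtain lab :: "nat set \<Rightarrow> nat" where lab: "inj_on lab (UNIV // R)"
    using finite_imp_inj_to_nat_seg[OF fin] by blast
  define T where "T c = {a. k \<le> a \<and> a mod p = num c}" for c
  have "infinite (T c)" if "c \<in> I" for c
  proof -
    have "num c < p" using num that by (auto simp: bij_betw_def)
    \<comment> \<open>The factor \<open>m + k\<close> moves the number with residue
      \<open>num c\<close> past both \<open>m\<close> and the initial segment.\<close>
    moreover have "m + k \<le> (m + k) * p + num c" for m
      using \<open>p > 0\<close> by (cases p) auto
    ultimately have "(m + k) * p + num c \<in> T c \<and> m \<le> (m + k) * p + num c" for m
      by (simp add: T_def) (meson add_leE)
    then show ?thesis unfolding infinite_nat_iff_unbounded_le by blast
  qed
  then have "\<forall>c\<in>I. \<exists>h. bij_betw h c (T c)"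
    using ex_bij_betw_infinite_nat_sets by (simp add: I_def)
  then obtain h where h: "\<And>c. c \<in> I \<Longrightarrow> bij_betw (h c) c (T c)" by metis
  define f where "f x = (if x \<in> A then g x else h (?c x) x)" for x
  define L where "L a = lab (if a < k then ?c (inv_into A g a) else inv_into I num (a mod p))" for a
  have f_fin: "f x < k" "inv_into A g (f x) = x" if "x \<in> A" for x
    using that g bij_betw_inv_into_left[OF g] by (auto simp: f_def bij_betw_def)
  have f_inf: "?c x \<in> I" "k \<le> f x" "f x mod p = num (?c x)" "f x = h (?c x) x" if "x \<notin> A" for x
  proof -
    show c: "?c x \<in> I" using that class_in by (simp add: A_def I_def)
    show fx: "f x = h (?c x) x" using that by (simp add: f_def)
    have "h (?c x) x \<in> T (?c x)" using h[OF c] self by (auto simp: bij_betw_def)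
    then show "k \<le> f x" "f x mod p = num (?c x)" by (simp_all add: fx T_def)
  qed
  have L_f: "L (f x) = lab (?c x)" for x
    using f_fin f_inf bij_betw_inv_into_left[OF num] by (cases "x \<in> A") (auto simp: L_def not_less[symmetric])
  have "inj f"
  proof (rule injI)
    fix x y assume eq: "f x = f y"
    show "x = y"
    proof (cases "x \<in> A")
      case True
      then have "y \<in> A" using f_fin(1)[of x] f_inf(2)[of y] eq by (metis not_less)
      then show ?thesis using True f_fin(2) eq by metis
    next
      case False
      then have y: "y \<notin> A" using f_fin(1)[of y] f_inf(2)[of x] eq by (metis not_less)
      then have "?c x = ?c y"
        using False f_inf eq num by (metis bij_betw_def inj_onD)
      then show ?thesis
        using False y f_inf(1,4) eq self h by (metis bij_betw_def inj_onD)
    qed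
  qed
  moreover have "\<exists>x. f x = a" for a
  proof (cases "a < k")
    case True
    then have "a \<in> g ` A" using g by (simp add: bij_betw_def)
    then obtain x where "x \<in> A" "g x = a" by blast
    then show ?thesis by (auto simp: f_def)
  next
    case False
    have "a mod p \<in> num ` I" using num \<open>p > 0\<close> by (simp add: bij_betw_def)
    then obtain c where c: "c \<in> I" "a mod p = num c" by blast
    then have "a \<in> h c ` c" using False h[OF c(1)] by (simp add: bij_betw_def T_def)
    then obtain x where x: "x \<in> c" "h c x = a" by blast
    obtain z where z: "c = ?c z" using c(1) unfolding I_def by (auto elim: quotientE)
    have "?c x = c" using equiv_class_eq[OF R, of z x] x(1) z by simp
    then have "f x = a" using c(1) x(2) by (simp add: f_def A_def I_def)
    then show ?thesis ..
  qed
  ultimately have "bij f" by (metis bijI surjI surj_def)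
  define S where "S = {(a, b). L a = L b}"
  have "(x, y) \<in> R \<longleftrightarrow> (f x, f y) \<in> S" for x y
    unfolding S_def using lab class_in eq_equiv_class_iff[OF R, of x y] by (auto simp: L_f dest: inj_onD)
  then have "isomorphic R S" using \<open>bij f\<close> unfolding isomorphic_def by blast
  moreover have "S \<in> EQ" unfolding S_def by (rule kernel_in_EQ)
  moreover have "S \<in> Pi0 n"
  proof -
    \<comment> \<open>Residues are below \<open>p\<close>, so the default \<open>0\<close> is never
      read.\<close>
    have "urec (\<lambda>j. if j < p then lab (inv_into I num j) else 0)"
      by (rule urec_finite_change[OF urec_const[of 0], of p]) simp
    from urec.comp[OF this urec_mod[OF urec_id, of p]]
    have "urec (\<lambda>a. lab (inv_into I num (a mod p)))" using \<open>p > 0\<close> by simp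
    then have L: "urec L" by (rule urec_finite_change[of _ k]) (simp add: L_def)
    show ?thesis unfolding Pi0_iff S_def by (simp, intro urec_intros urec.comp[OF L])
  qed
  ultimately show ?thesis using that by blast
qed

lemma delta_pi_copy:
  assumes "R \<in> EQ" "R \<in> Delta0 (Suc (Suc m))"
  obtains S where "S \<in> EQ" "S \<in> Pi0 (Suc m)" "isomorphic R S"
proof (cases "finite (UNIV // R)")
  case True
  then show ?thesis using finite_classes_computable_copy assms(1) that unfolding EQ_def by blast
next
  case False
  then show ?thesis using delta_infinite_classes_pi_copy assms that unfolding EQ_def by blast
qed

section \<open>Class sizes and structures without \<open>\<Sigma>\<^sub>n\<close> copies\<close>

text \<open>That \<open>u\<close> bounds the class is \<open>\<Pi>\<^sub>m\<^sub>+\<^sub>1\<close>,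
  and counting below \<open>u\<close> is \<open>\<Delta>\<^sub>m\<^sub>+\<^sub>2\<close>. Since
  infinite sets have \<open>card\<close> equal to \<open>0\<close>, the form \<open>Suc k\<close>
  forces a finite class.\<close>

lemma sigma_class_card:
  assumes R: "R \<in> Sigma0 (Suc m)"
  shows "sigma_rel (Suc (Suc m)) (\<lambda>k. \<exists>a. card {b. (a, b) \<in> R} = Suc k)"
proof -
  note R' = R[unfolded Sigma0_iff]
  have *: "(\<exists>u. (\<forall>z. u \<le> z \<longrightarrow> (a, z) \<notin> R) \<and> card {z. z < u \<and> (a, z) \<in> R} = Suc k) \<longleftrightarrow>
      card {b. (a, b) \<in> R} = Suc k" for a k
  proof
    assume "\<exists>u. (\<forall>z. u \<le> z \<longrightarrow> (a, z) \<notin> R) \<and> card {z. z < u \<and> (a, z) \<in> R} = Suc k"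
    then obtain u where u: "\<forall>z. u \<le> z \<longrightarrow> (a, z) \<notin> R" "card {z. z < u \<and> (a, z) \<in> R} = Suc k" by blast
    have "{b. (a, b) \<in> R} = {z. z < u \<and> (a, z) \<in> R}" using u(1) by (auto simp: not_le[symmetric])
    then show "card {b. (a, b) \<in> R} = Suc k" using u(2) by simp
  next
    assume card: "card {b. (a, b) \<in> R} = Suc k"
    then have "finite {b. (a, b) \<in> R}" by (intro card_ge_0_finite) simp
    then obtain u where u: "\<forall>b\<in>{b. (a, b) \<in> R}. b < u" unfolding finite_nat_set_iff_bounded by blast
    then have "{z. z < u \<and> (a, z) \<in> R} = {b. (a, b) \<in> R}" by auto
    then have "card {z. z < u \<and> (a, z) \<in> R} = Suc k" by (simp only: card)
    moreover have "\<forall>z. u \<le> z \<longrightarrow> (a, z) \<notin> R" using u by (auto simp: not_less[symmetric])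
    ultimately show "\<exists>u. (\<forall>z. u \<le> z \<longrightarrow> (a, z) \<notin> R) \<and> card {z. z < u \<and> (a, z) \<in> R} = Suc k"
      by blast
  qed
  have card: "delta_rel (Suc (Suc m)) (\<lambda>w. card {z. z < nfst w \<and> (nfst (nsnd w), z) \<in> R} = Suc (nsnd (nsnd w)))"
    by (intro delta_card urec_intros delta_subst2[of _ "\<lambda>x y. (x, y) \<in> R", OF delta_Suc_sigma[OF R']])
  have "sigma_rel (Suc (Suc m)) (\<lambda>k. \<exists>a u. (\<forall>z. u \<le> z \<longrightarrow> (a, z) \<notin> R) \<and>
      card {z. z < u \<and> (a, z) \<in> R} = Suc k)"
    by (intro sigma_ex sigma_conj sigma_Suc_if_pi pi_all pi_imp pi_not
        conjunct1[OF card[unfolded delta_rel_def]] urec_intros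
        sigma_subst2[of _ "\<lambda>x y. (x, y) \<in> R", OF R'])
  then show ?thesis by (simp add: *)
qed

lemma card_class_isomorphic:
  assumes "isomorphic R S"
  shows "(\<exists>a. card {b. (a, b) \<in> R} = k) \<longleftrightarrow> (\<exists>a. card {b. (a, b) \<in> S} = k)"
proof -
  obtain f where f: "bij f" "\<And>x y. (x, y) \<in> R \<longleftrightarrow> (f x, f y) \<in> S"
    using assms unfolding isomorphic_def by blast
  have "f ` {b. (a, b) \<in> R} = {b. (f a, b) \<in> S}" for a
  proof (intro equalityI subsetI)
    fix c assume c: "c \<in> {b. (f a, b) \<in> S}"
    obtain b where "c = f b" using bij_is_surj[OF f(1)] by blast
    then show "c \<in> f ` {b. (a, b) \<in> R}" using c f(2) by simp
  qed (use f(2) in auto)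
  then have card: "card {b. (f a, b) \<in> S} = card {b. (a, b) \<in> R}" for a
    using card_image[OF inj_on_subset[OF bij_is_inj[OF f(1)]], of "{b. (a, b) \<in> R}"] by simp
  then have "(\<exists>a. card {b. (a, b) \<in> R} = k) \<longleftrightarrow> (\<exists>a. card {b. (f a, b) \<in> S} = k)" by simp
  also have "\<dots> \<longleftrightarrow> (\<exists>a\<in>range f. card {b. (a, b) \<in> S} = k)" by blast
  finally show ?thesis by (simp add: bij_is_surj[OF f(1)])
qed

text \<open>The class sizes code a set \<open>P\<close> that is not
  \<open>\<Sigma>\<^sub>m\<^sub>+\<^sub>2\<close>, whereas a
  \<open>\<Sigma>\<^sub>m\<^sub>+\<^sub>1\<close> copy would make it so by
  \<open>sigma_class_card\<close>. Sizes are shifted by one because classes are nonempty.\<close>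

lemma delta_without_sigma_copy:
  obtains S where "S \<in> EQ" "S \<in> Delta0 (Suc (Suc m))"
    "\<And>R. R \<in> Sigma0 (Suc m) \<Longrightarrow> \<not> isomorphic R S"
proof -
  obtain P where P: "sigma_rel (Suc (Suc (Suc m))) P" "\<not> sigma_rel (Suc (Suc m)) P"
    by (rule sigma_hierarchy_proper)
  obtain Q where Q: "pi_rel (Suc (Suc m)) Q" "\<And>k. P k \<longleftrightarrow> (\<exists>x. Q (npair x k))"
    using P(1) by (rule sigma_Suc_E) blast
  obtain N where N: "pi_rel (Suc m) N" "\<And>z. \<not> Q z \<longleftrightarrow> (\<exists>v. N (npair v z))"
    using sigma_not[OF Q(1)] by (rule sigma_Suc_E) blast
  \<comment> \<open>The class with label \<open>Suc z\<close>, \<open>z = npair x k\<close>, has \<open>Suc k\<close> elements if \<open>Q z\<close> holds and is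
    infinite otherwise; the class with label \<open>0\<close> absorbs the remaining numbers and is infinite.\<close>
  define M where "M a \<longleftrightarrow> 0 < nsnd a \<and>
    (nfst a \<le> nsnd (nsnd a - 1) \<or> (\<exists>v<nfst a. N (npair v (nsnd a - 1))))" for a
  define L where "L a = (if M a then nsnd a else 0)" for a
  define S where "S = {(a, b). L a = L b}"
  \<comment> \<open>In the column of \<open>Suc z\<close>, the first \<open>nsnd z + 1\<close>
    numbers are always members; a refutation \<open>v\<close> of \<open>Q z\<close> admits all
    \<open>j > v\<close>.\<close>
  have M: "M (npair j (Suc z)) \<longleftrightarrow> j \<le> nsnd z \<or> (\<exists>v<j. N (npair v z))" for j z
    by (simp add: M_def)
  have delta_M: "delta_rel (Suc (Suc m)) M"
    unfolding M_def by (intro urec_intros delta_subst[OF delta_Suc_pi[OF N(1)]])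
  have "delta_rel (Suc (Suc m)) (\<lambda>e. (M (nfst e) \<and> M (nsnd e) \<and> nsnd (nfst e) = nsnd (nsnd e)) \<or>
      (\<not> M (nfst e) \<and> \<not> M (nsnd e)))"
    by (intro delta_disj delta_conj delta_not delta_subst[OF delta_M] urec_intros)
  moreover have "(a, b) \<in> S \<longleftrightarrow> (M a \<and> M b \<and> nsnd a = nsnd b) \<or> (\<not> M a \<and> \<not> M b)" for a b
    by (auto simp: S_def L_def M_def)
  ultimately have "S \<in> Delta0 (Suc (Suc m))" by (simp add: Delta0_iff)
  moreover have "S \<in> EQ" unfolding S_def by (rule kernel_in_EQ)
  moreover have "P k \<longleftrightarrow> (\<exists>a. card {b. (a, b) \<in> S} = Suc k)" for k
  proof -
    have L_Suc: "{b. L b = Suc z} = (\<lambda>j. npair j (Suc z)) ` {j. M (npair j (Suc z))}" for z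
      by (auto simp: L_def image_iff split: if_splits) (metis npair_nfst_nsnd)
    have card: "card {b. L b = Suc z} = (if Q z then Suc (nsnd z) else 0)" for z
    proof (cases "Q z")
      case True
      then have "{j. M (npair j (Suc z))} = {..nsnd z}" using N(2) by (auto simp: M)
      then show ?thesis using True by (simp add: L_Suc card_image inj_on_def)
    next
      case False
      then obtain v where "N (npair v z)" using N(2) by blast
      then have "{v<..} \<subseteq> {j. M (npair j (Suc z))}" by (auto simp: M)
      then have "infinite {j. M (npair j (Suc z))}" using infinite_Ioi finite_subset by blast
      then have "infinite {b. L b = Suc z}" by (simp add: L_Suc finite_image_iff inj_on_def)
      then show ?thesis using False by simp
    qed
    \<comment> \<open>These numbers never satisfy \<open>M\<close>, so the class with label
      \<open>0\<close> is infinite; its \<open>card\<close> is \<open>0\<close> and contributes no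
      \<open>Suc k\<close>.\<close>
    have "range (\<lambda>j. npair j 0) \<subseteq> {b. L b = 0}" by (auto simp: L_def M_def)
    moreover have "infinite (range (\<lambda>j. npair j 0))" by (intro range_inj_infinite) (simp add: inj_def)
    ultimately have "infinite {b. L b = 0}" using finite_subset by blast
    then have card_0: "card {b. L b = 0} = 0" by simp
    show ?thesis
    proof
      assume "P k"
      then obtain x where "Q (npair x k)" using Q(2) by blast
      moreover have "L (npair 0 (Suc (npair x k))) = Suc (npair x k)" by (simp add: L_def M)
      ultimately have "card {b. (npair 0 (Suc (npair x k)), b) \<in> S} = Suc k"
        using card[of "npair x k"] by (simp add: S_def eq_commute)
      then show "\<exists>a. card {b. (a, b) \<in> S} = Suc k" ..
    next
      assume "\<exists>a. card {b. (a, b) \<in> S} = Suc k"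
      then obtain a where a: "card {b. L b = L a} = Suc k" by (auto simp: S_def eq_commute)
      then obtain z where "L a = Suc z" using card_0 by (cases "L a") auto
      then have "Q z" "nsnd z = k" using a card[of z] by (auto split: if_splits)
      then show "P k" using Q(2) by (metis npair_nfst_nsnd)
    qed
  qed
  then have P_eq: "P = (\<lambda>k. \<exists>a. card {b. (a, b) \<in> S} = Suc k)" by (rule ext)
  have "\<not> isomorphic R S" if "R \<in> Sigma0 (Suc m)" for R
    using sigma_class_card[OF that] P(2) card_class_isomorphic[of R S] unfolding P_eq by auto
  ultimately show ?thesis using that by blast
qed

theorem theorem2p3:
  fixes n :: nat
  assumes "n > 0"
  shows "IsoType EQ (Sigma0 n) \<subset> IsoType EQ (Pi0 n) \<and>
    IsoType EQ (Pi0 n) = IsoType EQ (Delta0 (n + 1))"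
proof -
  obtain m where n: "n = Suc m" using assms gr0_implies_Suc by blast
  have "Sigma0 n \<subseteq> Delta0 (n + 1)" "Pi0 n \<subseteq> Delta0 (n + 1)"
    by (auto simp: Sigma0_iff Pi0_iff Delta0_iff delta_Suc_sigma delta_Suc_pi)
  then have sub: "IsoType EQ (Sigma0 n) \<subseteq> IsoType EQ (Delta0 (n + 1))"
    "IsoType EQ (Pi0 n) \<subseteq> IsoType EQ (Delta0 (n + 1))"
    unfolding IsoType_def by blast+
  have "IsoType EQ (Delta0 (n + 1)) \<subseteq> IsoType EQ (Pi0 n)"
    unfolding IsoType_subset_iff n by (metis Int_iff Suc_eq_plus1 delta_pi_copy)
  then have eq: "IsoType EQ (Pi0 n) = IsoType EQ (Delta0 (n + 1))" using sub by blast
  obtain S where S: "S \<in> EQ" "S \<in> Delta0 (n + 1)" "\<And>R. R \<in> Sigma0 n \<Longrightarrow> \<not> isomorphic R S"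
    using delta_without_sigma_copy[of m] by (auto simp: n)
  \<comment> \<open>As the \<open>\<Pi>\<^sub>n\<close> and
    \<open>\<Delta>\<^sub>n\<^sub>+\<^sub>1\<close> types coincide, a
    \<open>\<Delta>\<^sub>n\<^sub>+\<^sub>1\<close> structure suffices for strictness.\<close>
  have "\<not> IsoType EQ (Delta0 (n + 1)) \<subseteq> IsoType EQ (Sigma0 n)"
    unfolding IsoType_subset_iff using S isomorphic_sym by blast
  then show ?thesis using sub eq by blast
qed

end
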